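(* Let $F$ be any field, $n\ge1$, and let $h_n\in\mathbb Z[X_1,\dots,X_n]$ be the polynomial defined in the context. Let $f=X^n+a_1X^{n-1}+\cdots+a_n\in F[X]$ be separable and irreducible with cyclic Galois group over $F$. If $h_n(a_1,\dots,a_n)\ne0$ (evaluated in $F$), then $f$ is normal over $F$, i.e., the roots of $f$ form a basis of the splitting field $K$ of $f$ over $F$.
   Context: For $m\ge1$ let $\epsilon_m=e^{2\pi\sqrt{-1}/m}$ and $\Psi_m(X_0,\dots,X_{m-1})=\prod_{i\in(\mathbb Z/m\mathbb Z)^\times}\bigl(\sum_{j\in\mathbb Z/m\mathbb Z}\epsilon_m^{ij}X_j\bigr)$, which lies in $\mathbb Z[X_0,\dots,X_{m-1}]$. Let $S_m$ act on polynomials in $X_0,\dots,X_{m-1}$ by $\sigma(X_j)=X_{\sigma(j)}$, let $\mathrm{Stab}(\Psi_m)$ be the stabilizer of $\Psi_m$, let $\mathcal C_m$ be a system of representatives of the left cosets of $\mathrm{Stab}(\Psi_m)$ in $S_m$, and set $\Phi_m=\prod_{\sigma\in\mathcal C_m}\sigma(\Psi_m)$ (a symmetric polynomial in $\mathbb Z[X_0,\dots,X_{m-1}]$, independent of the choice of $\mathcal C_m$). For $m\mid n$, let $\mathcal P_{n,m}$ be the set of unordered partitions of $\{0,1,\dots,n-1\}$ into $m$ parts $P_0,\dots,P_{m-1}$ each of size $n/m$, and define \[ \Theta_{n,m}(X_0,\dots,X_{n-1})=\prod_{\{P_0,\dots,P_{m-1}\}\in\mathcal P_{n,m}}\Phi_m\Bigl(\sum_{a\in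 P_0}X_a,\dots,\sum_{a\in P_{m-1}}X_a\Bigr). \] $\Theta_{n,m}$ is a symmetric polynomial in $\mathbb Z[X_0,\dots,X_{n-1}]$, so there is a unique $\theta_{n,m}\in\mathbb Z[X_1,\dots,X_n]$ with $\Theta_{n,m}(X_0,\dots,X_{n-1})=\theta_{n,m}(s_1,\dots,s_n)$, where $s_i$ is the $i$-th elementary symmetric polynomial in $X_0,\dots,X_{n-1}$. Finally $h_n=\prod_{m\mid n}\theta_{n,m}$. *)

theory Defs
  imports Complex_Main "HOL-Library.Poly_Mapping" "HOL-Library.Disjoint_Sets"
    "HOL-Combinatorics.Permutations" "HOL-Computational_Algebra.Polynomial_Factorial"
begin

type_synonym 'a mpoly = "(nat \<Rightarrow>\<^sub>0 nat) \<Rightarrow>\<^sub>0 'a"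

definition mVar :: "nat \<Rightarrow> 'a::comm_ring_1 mpoly" where
  "mVar i = Poly_Mapping.single (Poly_Mapping.single i 1) 1"

definition mConst :: "'a::comm_ring_1 \<Rightarrow> 'a mpoly" where
  "mConst c = Poly_Mapping.single 0 c"

definition mp_eval :: "('a::zero \<Rightarrow> 'b::comm_ring_1) \<Rightarrow> (nat \<Rightarrow> 'b) \<Rightarrow> 'a mpoly \<Rightarrow> 'b" where
  "mp_eval cf v p =
     (\<Sum>\<mu>\<in>Poly_Mapping.keys p. cf (Poly_Mapping.lookup p \<mu>) *
        (\<Prod>i\<in>Poly_Mapping.keys \<mu>. v i ^ Poly_Mapping.lookup \<mu> i))"

definition mp_perm :: "(nat \<Rightarrow> nat) \<Rightarrow> 'a::comm_ring_1 mpoly \<Rightarrow> 'a mpoly" where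
  "mp_perm \<sigma> p = mp_eval mConst (\<lambda>j. mVar (\<sigma> j)) p"

definition mp_vars_in :: "nat set \<Rightarrow> 'a::zero mpoly \<Rightarrow> bool" where
  "mp_vars_in V p \<longleftrightarrow> (\<forall>\<mu>\<in>Poly_Mapping.keys p. Poly_Mapping.keys \<mu> \<subseteq> V)"

definition eps :: "nat \<Rightarrow> complex" where
  "eps m = exp (2 * pi * \<i> / of_nat m)"

definition Psi :: "nat \<Rightarrow> complex mpoly" where
  "Psi m = (\<Prod>i\<in>{i\<in>{..<m}. coprime i m}. (\<Sum>j<m. mConst (eps m ^ (i * j)) * mVar j))"

definition Sym :: "nat \<Rightarrow> (nat \<Rightarrow> nat) set" where
  "Sym m = {\<sigma>. \<sigma> permutes {..<m}}"

definition StabPsi :: "nat \<Rightarrow> (nat \<Rightarrow> nat) set" where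
  "StabPsi m = {\<sigma>\<in>Sym m. mp_perm \<sigma> (Psi m) = Psi m}"

definition left_cosets_Stab :: "nat \<Rightarrow> (nat \<Rightarrow> nat) set set" where
  "left_cosets_Stab m = {(\<lambda>\<tau>. \<sigma> \<circ> \<tau>) ` StabPsi m | \<sigma>. \<sigma> \<in> Sym m}"

definition Phi :: "nat \<Rightarrow> complex mpoly" where
  "Phi m = (\<Prod>C\<in>left_cosets_Stab m. mp_perm (SOME \<sigma>. \<sigma> \<in> C) (Psi m))"

definition Partitions :: "nat \<Rightarrow> nat \<Rightarrow> nat set set set" where
  "Partitions n m = {Q. partition_on {..<n} Q \<and> card Q = m \<and> (\<forall>P\<in>Q. card P = n div m)}"

definition blocks_enum :: "nat \<Rightarrow> nat set set \<Rightarrow> nat \<Rightarrow> nat set" where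
  "blocks_enum m Q = (SOME g. bij_betw g {..<m} Q)"

definition Theta :: "nat \<Rightarrow> nat \<Rightarrow> complex mpoly" where
  "Theta n m = (\<Prod>Q\<in>Partitions n m.
      mp_eval mConst (\<lambda>j. if j < m then (\<Sum>a\<in>blocks_enum m Q j. mVar a) else 0) (Phi m))"

definition esym :: "nat \<Rightarrow> nat \<Rightarrow> 'a::comm_ring_1 mpoly" where
  "esym n i = (\<Sum>S\<in>{S. S \<subseteq> {..<n} \<and> card S = i}. \<Prod>a\<in>S. mVar a)"

definition theta :: "nat \<Rightarrow> nat \<Rightarrow> int mpoly" where
  "theta n m = (THE p. mp_vars_in {1..n} p \<and>
        mp_eval (\<lambda>c. mConst (of_int c)) (\<lambda>i. esym n i) p = Theta n m)"

definition h :: "nat \<Rightarrow> int mpoly" where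
  "h n = (\<Prod>m\<in>{m. m dvd n}. theta n m)"

definition is_subfield :: "'b::field set \<Rightarrow> bool" where
  "is_subfield S \<longleftrightarrow> 0 \<in> S \<and> 1 \<in> S \<and> (\<forall>x\<in>S. \<forall>y\<in>S. x + y \<in> S \<and> x - y \<in> S \<and> x * y \<in> S)
      \<and> (\<forall>x\<in>S. inverse x \<in> S)"

definition field_hom :: "('a::field \<Rightarrow> 'b::field) \<Rightarrow> bool" where
  "field_hom e \<longleftrightarrow> e 1 = 1 \<and> (\<forall>x y. e (x + y) = e x + e y \<and> e (x * y) = e x * e y)"

definition is_splitting_field :: "('a::field \<Rightarrow> 'b::field) \<Rightarrow> 'a poly \<Rightarrow> bool" where
  "is_splitting_field e f \<longleftrightarrow> field_hom e \<and>
     (\<exists>c rs. map_poly e f = smult c (\<Prod>r\<leftarrow>rs. [:- r, 1:])) \<and>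
     (\<forall>S. is_subfield S \<and> range e \<subseteq> S \<and> {x. poly (map_poly e f) x = 0} \<subseteq> S \<longrightarrow> S = UNIV)"

definition Gal :: "('a::field \<Rightarrow> 'b::field) \<Rightarrow> ('b \<Rightarrow> 'b) set" where
  "Gal e = {\<sigma>. bij \<sigma> \<and> field_hom \<sigma> \<and> (\<forall>x. \<sigma> (e x) = e x)}"

definition cyclic_fun_group :: "('b \<Rightarrow> 'b) set \<Rightarrow> bool" where
  "cyclic_fun_group G \<longleftrightarrow> (\<exists>\<tau>\<in>G. G = {\<tau> ^^ k | k. True})"

end

theory Submission
  imports Defs "Jordan_Normal_Form.Determinant"
begin

text \<open>
  Let $\tau$ generate the Galois group and let $r_i = \tau^i(r)$ be the roots. Over $\mathbb{C}$ the
  circulant determinant of $x_0, \dots, x_{n-1}$ factors over the $n$-th roots of unity; grouping these by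
  their order $d$ gives $\prod_{d \mid n} \Psi_d(y^{(d)})$, where $y^{(d)}_j$ is the sum of the $x_i$ with
  $i \equiv j$ modulo $d$. By induction on $n$ this identity also shows that $\Psi_n$ has integer
  coefficients, since it exhibits $\Psi_n$ as the quotient of an integral polynomial by an integral one with
  leading coefficient $1$. The identity is therefore valid in every commutative ring, and no roots
  of unity are needed in the field $K$: if the circulant determinant of the $-r_i$ vanishes, so does some
  $\Psi_d(y^{(d)})$, which is a factor of $\Theta_{n,d}(-r_0, \dots, -r_{n-1})
  = \theta_{n,d}(a_1, \dots, a_n)$. If the determinant does not vanish, then the linear systems
  $\sum_i c_i \tau^k(r_i) = \tau^k(y)$, for all $k$, are uniquely solvable; uniqueness makes the solution
  $\tau$-invariant, so that it lies in the base field.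
\<close>

section \<open>Evaluation of multivariate polynomials\<close>

text \<open>\<open>theta\<close> is a definite description, so nothing is known about it before
  existence and uniqueness are settled. This is why the fundamental theorem on symmetric polynomials
  appears, over any commutative ring so that it applies directly to the integers.
  \<open>Psi\<close>, \<open>Phi\<close> and \<open>Theta\<close> have complex coefficients and
  cannot be evaluated in a field of positive characteristic; each gets an integral counterpart
  (\<open>PsiZ\<close>, \<open>PhiZ\<close>, \<open>ThetaZ\<close>), identified through the
  injection \<open>to_complex\<close>, and only these are evaluated. The signs come from writing f
  as the product of the X + (-r_i), whose coefficients are the elementary symmetric polynomials in
  the -r_i. The Galois side must supply two facts: an element fixed by \<tau> lies in the base
  field, which rests on separability, and the \<tau>-orbit of one root is the whole root set, which
  rests on irreducibility.\<close>

abbreviation "lkp \<equiv> Poly_Mapping.lookup"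
abbreviation "kys \<equiv> Poly_Mapping.keys"

definition monom_eval :: "(nat \<Rightarrow> 'b::comm_ring_1) \<Rightarrow> (nat \<Rightarrow>\<^sub>0 nat) \<Rightarrow> 'b" where
  "monom_eval v \<mu> = (\<Prod>i\<in>kys \<mu>. v i ^ lkp \<mu> i)"

lemma mp_eval_alt: "mp_eval cf v p = (\<Sum>\<mu>\<in>kys p. cf (lkp p \<mu>) * monom_eval v \<mu>)"
  by (simp add: mp_eval_def monom_eval_def)

lemma monom_eval_superset:
  assumes "finite A" "kys \<mu> \<subseteq> A"
  shows "monom_eval v \<mu> = (\<Prod>i\<in>A. v i ^ lkp \<mu> i)"
  unfolding monom_eval_def using assms
  by (intro prod.mono_neutral_left) (auto simp: in_keys_iff)

lemma monom_eval_0 [simp]: "monom_eval v 0 = 1"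
  by (simp add: monom_eval_def)

lemma monom_eval_add: "monom_eval v (\<mu> + \<nu>) = monom_eval v \<mu> * monom_eval v \<nu>"
proof -
  let ?A = "kys \<mu> \<union> kys \<nu>"
  have "kys (\<mu> + \<nu>) \<subseteq> ?A" by (rule Poly_Mapping.keys_add)
  then show ?thesis
    by (simp add: monom_eval_superset[of ?A] lookup_add power_add prod.distrib)
qed

lemma monom_eval_single [simp]: "monom_eval v (Poly_Mapping.single i k) = v i ^ k"
  by (simp add: monom_eval_superset[of "{i}"])

lemma mp_eval_superset:
  assumes "cf 0 = 0" "finite A" "kys p \<subseteq> A"
  shows "mp_eval cf v p = (\<Sum>\<mu>\<in>A. cf (lkp p \<mu>) * monom_eval v \<mu>)"
  unfolding mp_eval_alt using assms
  by (intro sum.mono_neutral_left) (auto simp: in_keys_iff)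

lemma mp_eval_cong:
  assumes "mp_vars_in V p" "\<And>i. i \<in> V \<Longrightarrow> v i = w i"
  shows "mp_eval cf v p = mp_eval cf w p"
  using assms unfolding mp_eval_alt monom_eval_def mp_vars_in_def
  by (intro sum.cong refl arg_cong2[of _ _ _ _ "(*)"] prod.cong arg_cong2[of _ _ _ _ "(^)"]) auto

lemma poly_mapping_sum_singles:
  "p = (\<Sum>\<mu>\<in>kys p. Poly_Mapping.single \<mu> (lkp p \<mu>))"
proof (rule poly_mapping_eqI)
  fix k
  have "(\<Sum>\<mu>\<in>kys p. lkp (Poly_Mapping.single \<mu> (lkp p \<mu>)) k) = (\<Sum>\<mu>\<in>kys p. if \<mu> = k then lkp p k else 0)"
    by (intro sum.cong) (auto simp: lookup_single)
  also have "\<dots> = lkp p k" by (auto simp: in_keys_iff)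
  finally show "lkp p k = lkp (\<Sum>\<mu>\<in>kys p. Poly_Mapping.single \<mu> (lkp p \<mu>)) k"
    by (simp add: lookup_sum)
qed

context comm_ring_hom
begin

lemma mp_eval_zero [simp]: "mp_eval hom v 0 = 0"
  by (simp add: mp_eval_alt)

lemma mp_eval_single: "mp_eval hom v (Poly_Mapping.single \<mu> c) = hom c * monom_eval v \<mu>"
  by (subst mp_eval_superset[of _ "{\<mu>}"]) auto

lemma mp_eval_add: "mp_eval hom v (p + q) = mp_eval hom v p + mp_eval hom v q"
proof -
  let ?A = "kys p \<union> kys q"
  have "kys (p + q) \<subseteq> ?A" by (rule Poly_Mapping.keys_add)
  then show ?thesis
    by (simp add: mp_eval_superset[of _ ?A] lookup_add hom_add distrib_right sum.distrib)
qed

lemma mp_eval_sum: "mp_eval hom v (\<Sum>a\<in>A. g a) = (\<Sum>a\<in>A. mp_eval hom v (g a))"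
  by (induction A rule: infinite_finite_induct) (auto simp: mp_eval_add)

lemma mp_eval_mult: "mp_eval hom v (p * q) = mp_eval hom v p * mp_eval hom v q"
proof -
  let ?s = "\<lambda>p \<mu>. Poly_Mapping.single \<mu> (lkp p \<mu>)"
  have "p * q = (\<Sum>\<mu>\<in>kys p. ?s p \<mu>) * (\<Sum>\<mu>\<in>kys q. ?s q \<mu>)"
    using poly_mapping_sum_singles by metis
  also have "\<dots> = (\<Sum>\<mu>\<in>kys p. \<Sum>\<nu>\<in>kys q. ?s p \<mu> * ?s q \<nu>)"
    by (rule sum_product)
  finally have "mp_eval hom v (p * q) = (\<Sum>\<mu>\<in>kys p. \<Sum>\<nu>\<in>kys q.
      (hom (lkp p \<mu>) * monom_eval v \<mu>) * (hom (lkp q \<nu>) * monom_eval v \<nu>))"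
    by (simp add: mp_eval_sum mult_single mp_eval_single hom_mult monom_eval_add mult_ac)
  also have "\<dots> = mp_eval hom v p * mp_eval hom v q"
    by (simp add: mp_eval_alt sum_product)
  finally show ?thesis .
qed

lemma mp_eval_one [simp]: "mp_eval hom v 1 = 1"
  using mp_eval_single[of v 0 1] by simp

lemma comm_ring_hom_mp_eval: "comm_ring_hom (mp_eval hom v)"
  by unfold_locales (auto simp: mp_eval_add mp_eval_mult)

lemma mp_eval_mVar [simp]: "mp_eval hom v (mVar i) = v i"
  by (simp add: mVar_def mp_eval_single)

lemma mp_eval_mConst [simp]: "mp_eval hom v (mConst c) = hom c"
  by (simp add: mConst_def mp_eval_single)

lemma hom_mp_eval: "hom (mp_eval cf v p) = mp_eval (\<lambda>c. hom (cf c)) (\<lambda>i. hom (v i)) p"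
  by (simp add: mp_eval_def hom_sum hom_mult hom_prod hom_power)

end

section \<open>Coefficient maps and the embedding of integral polynomials\<close>

lemma comm_ring_hom_mConst: "comm_ring_hom mConst"
  by unfold_locales (auto simp: mConst_def single_add mult_single)

lemma comm_ring_hom_comp:
  assumes "comm_ring_hom f" "comm_ring_hom g"
  shows "comm_ring_hom (\<lambda>x. f (g x))"
proof -
  interpret f: comm_ring_hom f by fact
  interpret g: comm_ring_hom g by fact
  show ?thesis by unfold_locales (auto simp: f.hom_add f.hom_mult g.hom_add g.hom_mult)
qed

lemma comm_ring_hom_of_int: "comm_ring_hom (of_int :: int \<Rightarrow> 'a::comm_ring_1)"
  by unfold_locales auto

lemma mVar_power: "mVar i ^ k = Poly_Mapping.single (Poly_Mapping.single i k) 1"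
  by (induction k) (auto simp: mVar_def mult_single simp flip: single_add)

lemma prod_single_one:
  "finite A \<Longrightarrow> (\<Prod>a\<in>A. Poly_Mapping.single (g a) (1::'a::comm_ring_1)) = Poly_Mapping.single (\<Sum>a\<in>A. g a) 1"
  by (induction A rule: finite_induct) (auto simp: mult_single)

lemma monom_eval_mVar: "monom_eval mVar \<mu> = Poly_Mapping.single \<mu> 1"
  using poly_mapping_sum_singles[of \<mu>]
  by (simp add: monom_eval_def mVar_power prod_single_one)

lemma lookup_mp_eval_mConst_mVar:
  assumes "cf 0 = 0"
  shows "lkp (mp_eval (\<lambda>c. mConst (cf c)) mVar p) \<mu> = cf (lkp p \<mu>)"
proof -
  have "lkp (mp_eval (\<lambda>c. mConst (cf c)) mVar p) \<mu>
      = (\<Sum>\<nu>\<in>kys p. if \<nu> = \<mu> then cf (lkp p \<mu>) else 0)"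
    by (auto intro!: sum.cong simp: mp_eval_alt monom_eval_mVar lookup_sum mConst_def mult_single
          lookup_single when_def simp del: sum.delta sum.delta')
  also have "\<dots> = cf (lkp p \<mu>)" using assms by (auto simp: in_keys_iff)
  finally show ?thesis .
qed

lemma mp_eval_mConst_mVar [simp]: "mp_eval mConst mVar p = p"
  by (rule poly_mapping_eqI) (rule lookup_mp_eval_mConst_mVar[of "\<lambda>c. c"], simp)

text \<open>This is the coefficientwise embedding. Phrasing it as an evaluation makes it a ring
  homomorphism at once.\<close>

definition to_complex :: "int mpoly \<Rightarrow> complex mpoly" where
  "to_complex = mp_eval (\<lambda>c. mConst (of_int c)) mVar"

lemma comm_ring_hom_mConst_of_int:
  "comm_ring_hom (\<lambda>c. mConst (of_int c) :: 'a::comm_ring_1 mpoly)"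
  by (rule comm_ring_hom_comp[OF comm_ring_hom_mConst comm_ring_hom_of_int])

interpretation mConst: comm_ring_hom mConst
  by (rule comm_ring_hom_mConst)

interpretation mConst_int: comm_ring_hom "\<lambda>c. mConst (of_int c)"
  by (rule comm_ring_hom_mConst_of_int)

interpretation to_complex: comm_ring_hom to_complex
  unfolding to_complex_def by (rule mConst_int.comm_ring_hom_mp_eval)

lemma lookup_to_complex: "lkp (to_complex p) \<mu> = of_int (lkp p \<mu>)"
  unfolding to_complex_def by (rule lookup_mp_eval_mConst_mVar) simp

lemma inj_to_complex: "inj to_complex"
proof (rule injI)
  fix p q assume "to_complex p = to_complex q"
  then have "lkp (to_complex p) k = lkp (to_complex q) k" for k by simp
  then show "p = q" by (intro poly_mapping_eqI) (simp add: lookup_to_complex)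
qed

lemma range_to_complexI:
  assumes "\<And>\<mu>. lkp p \<mu> \<in> \<int>"
  shows "p \<in> range to_complex"
proof -
  \<comment> \<open>An integer z, viewed as a complex number, is recovered as the floor of its real
    part.\<close>
  let ?q = "Poly_Mapping.map (\<lambda>z. \<lfloor>Re z\<rfloor>) p"
  have "lkp (to_complex ?q) k = lkp p k" for k
    using assms[of k] by (auto simp: lookup_to_complex map.rep_eq when_def elim!: Ints_cases)
  then have "to_complex ?q = p" by (intro poly_mapping_eqI)
  then show ?thesis by (metis rangeI)
qed

lemma to_complex_mVar [simp]: "to_complex (mVar i) = mVar i"
  by (simp add: to_complex_def)

lemma to_complex_mConst [simp]: "to_complex (mConst c) = mConst (of_int c)"
  by (simp add: to_complex_def)

lemma to_complex_mp_eval: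
  "to_complex (mp_eval mConst v p) = mp_eval mConst (\<lambda>i. to_complex (v i)) (to_complex p)"
proof -
  have "mp_eval mConst (\<lambda>i. to_complex (v i)) (to_complex p)
      = mp_eval (\<lambda>c. mConst (of_int c)) (\<lambda>i. to_complex (v i)) p"
    using mConst.comm_ring_hom_mp_eval[of "\<lambda>i. to_complex (v i)"]
    unfolding to_complex_def by (simp add: comm_ring_hom.hom_mp_eval)
  then show ?thesis by (simp add: to_complex.hom_mp_eval)
qed

lemma to_complex_mp_perm: "to_complex (mp_perm \<sigma> p) = mp_perm \<sigma> (to_complex p)"
  by (simp add: mp_perm_def to_complex_mp_eval)

interpretation mp_perm: comm_ring_hom "mp_perm \<sigma>"
  unfolding mp_perm_def by (rule mConst.comm_ring_hom_mp_eval)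

lemma mp_perm_mVar [simp]: "mp_perm \<sigma> (mVar i) = mVar (\<sigma> i)"
  by (simp add: mp_perm_def)

lemma mp_eval_mp_perm:
  assumes "comm_ring_hom cf"
  shows "mp_eval cf v (mp_perm \<sigma> p) = mp_eval cf (\<lambda>i. v (\<sigma> i)) p"
proof -
  interpret cf: comm_ring_hom cf by fact
  interpret E: comm_ring_hom "mp_eval cf v" by (rule cf.comm_ring_hom_mp_eval)
  show ?thesis by (simp add: mp_perm_def E.hom_mp_eval)
qed

lemma mp_perm_comp: "mp_perm \<sigma> (mp_perm \<tau> p) = mp_perm (\<sigma> \<circ> \<tau>) p"
  using mp_eval_mp_perm[OF comm_ring_hom_mConst, of "\<lambda>i. mVar (\<sigma> i)" \<tau> p]
  by (simp add: mp_perm_def)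

lemma mp_perm_id [simp]: "mp_perm id p = p"
  by (simp add: mp_perm_def)

section \<open>Symmetric polynomials\<close>

text \<open>The order on exponents is the lexicographic one of \<^theory>\<open>HOL-Library.Poly_Mapping\<close>, in which
  $X_0$ is the most significant variable. The coefficient \<^term>\<open>c\<close> may be zero.\<close>

definition has_lead :: "'a::comm_ring_1 mpoly \<Rightarrow> (nat \<Rightarrow>\<^sub>0 nat) \<Rightarrow> 'a \<Rightarrow> bool" where
  "has_lead p \<mu> c \<longleftrightarrow> lkp p \<mu> = c \<and> (\<forall>\<nu>\<in>kys p. \<nu> \<le> \<mu>)"

section \<open>Leading terms in the lexicographic order\<close>

lemma less_exponent_iff:
  fixes \<mu> \<nu> :: "nat \<Rightarrow>\<^sub>0 nat"
  shows "\<mu> < \<nu> \<longleftrightarrow> (\<exists>k. lkp \<mu> k < lkp \<nu> k \<and> (\<forall>k'<k. lkp \<mu> k' = lkp \<nu> k'))"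
  by (simp add: less_poly_mapping.rep_eq less_fun_def)

text \<open>Summing over supersets of the supports lets a designated leading exponent take part even
  when its coefficient is zero.\<close>

lemma lookup_mult_superset:
  fixes p q :: "'a::comm_ring_1 mpoly"
  assumes "finite A" "kys p \<subseteq> A" "finite B" "kys q \<subseteq> B"
  shows "lkp (p * q) k = (\<Sum>\<mu>\<in>A. \<Sum>\<nu>\<in>B. if \<mu> + \<nu> = k then lkp p \<mu> * lkp q \<nu> else 0)"
proof -
  let ?s = "\<lambda>p \<mu>. Poly_Mapping.single \<mu> (lkp p \<mu>)"
  have *: "r = (\<Sum>\<mu>\<in>C. ?s r \<mu>)" if "finite C" "kys r \<subseteq> C" for r :: "'a mpoly" and C
    using that by (subst poly_mapping_sum_singles, intro sum.mono_neutral_left)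
                  (auto simp: in_keys_iff)
  have "p * q = (\<Sum>\<mu>\<in>A. ?s p \<mu>) * (\<Sum>\<nu>\<in>B. ?s q \<nu>)"
    using *[OF assms(1,2)] *[OF assms(3,4)] by metis
  also have "\<dots> = (\<Sum>\<mu>\<in>A. \<Sum>\<nu>\<in>B. Poly_Mapping.single (\<mu> + \<nu>) (lkp p \<mu> * lkp q \<nu>))"
    by (simp add: sum_product mult_single)
  finally show ?thesis
    by (simp add: lookup_sum lookup_single when_def)
qed

lemma keys_sum_subset: "kys (\<Sum>a\<in>A. f a) \<subseteq> (\<Union>a\<in>A. kys (f a))"
  by (induction A rule: infinite_finite_induct) (auto dest!: subsetD[OF Poly_Mapping.keys_add])

text \<open>Addition of exponents is strictly monotone, so among exponents bounded by \<mu> and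
  \<nu> only the pair (\<mu>, \<nu>) itself adds up to the top exponent. Hence nothing can cancel
  there, and since a zero leading coefficient is permitted, zero divisors do no harm.\<close>

lemma has_lead_mult:
  assumes "has_lead p \<mu> a" "has_lead q \<nu> b"
  shows "has_lead (p * q) (\<mu> + \<nu>) (a * b)"
proof -
  have le: "\<kappa> \<le> \<mu>" if "\<kappa> \<in> insert \<mu> (kys p)" for \<kappa>
    using that assms by (auto simp: has_lead_def)
  have le': "\<kappa> \<le> \<nu>" if "\<kappa> \<in> insert \<nu> (kys q)" for \<kappa>
    using that assms by (auto simp: has_lead_def)
  have "kys (p * q) \<subseteq> {\<kappa> + \<rho> |\<kappa> \<rho>. \<kappa> \<in> kys p \<and> \<rho> \<in> kys q}"
    by (rule Poly_Mapping.keys_mult)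
  then have "\<forall>\<kappa>\<in>kys (p * q). \<kappa> \<le> \<mu> + \<nu>"
    using le le' by (fastforce intro: add_mono)
  moreover have "lkp (p * q) (\<mu> + \<nu>) = a * b"
  proof -
    have "lkp (p * q) (\<mu> + \<nu>) = (\<Sum>\<kappa>\<in>insert \<mu> (kys p). \<Sum>\<rho>\<in>insert \<nu> (kys q).
        if \<kappa> + \<rho> = \<mu> + \<nu> then lkp p \<kappa> * lkp q \<rho> else 0)"
      by (rule lookup_mult_superset) auto
    also have "\<dots> = (\<Sum>\<kappa>\<in>insert \<mu> (kys p). \<Sum>\<rho>\<in>insert \<nu> (kys q).
        if \<rho> = \<nu> then (if \<kappa> = \<mu> then a * b else 0) else 0)"
    proof (intro sum.cong refl)
      fix \<kappa> \<rho> assume "\<kappa> \<in> insert \<mu> (kys p)" "\<rho> \<in> insert \<nu> (kys q)"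
      then have "\<kappa> \<le> \<mu>" "\<rho> \<le> \<nu>" using le le' by auto
      then have "\<kappa> + \<rho> = \<mu> + \<nu> \<longleftrightarrow> \<kappa> = \<mu> \<and> \<rho> = \<nu>"
        by (metis add_le_less_mono add_less_le_mono order.strict_iff_order)
      then show "(if \<kappa> + \<rho> = \<mu> + \<nu> then lkp p \<kappa> * lkp q \<rho> else 0) =
        (if \<rho> = \<nu> then (if \<kappa> = \<mu> then a * b else 0) else 0)"
        using assms by (auto simp: has_lead_def)
    qed
    also have "\<dots> = a * b"
      by (subst sum.delta, simp)+ simp
    finally show ?thesis .
  qed
  ultimately show ?thesis by (simp add: has_lead_def)
qed

lemma has_lead_one: "has_lead 1 0 1"
  by (simp add: has_lead_def)

lemma has_lead_prod:
  assumes "finite A" "\<And>a. a \<in> A \<Longrightarrow> has_lead (f a) (g a) (c a)"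
  shows "has_lead (\<Prod>a\<in>A. f a) (\<Sum>a\<in>A. g a) (\<Prod>a\<in>A. c a)"
  using assms by (induction A rule: finite_induct) (auto intro: has_lead_one has_lead_mult)

lemma has_lead_power:
  "has_lead p \<mu> c \<Longrightarrow> has_lead (p ^ k) (\<Sum>_<k. \<mu>) (c ^ k)"
  using has_lead_prod[of "{..<k}" "\<lambda>_. p" "\<lambda>_. \<mu>" "\<lambda>_. c"] by simp

section \<open>Variables occurring in a polynomial\<close>

lemma mp_vars_in_mult:
  assumes "mp_vars_in V p" "mp_vars_in V q"
  shows "mp_vars_in V (p * q)"
  unfolding mp_vars_in_def
proof
  fix \<mu> assume "\<mu> \<in> kys (p * q)"
  then obtain \<kappa> \<rho> where "\<mu> = \<kappa> + \<rho>" "\<kappa> \<in> kys p" "\<rho> \<in> kys q"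
    using Poly_Mapping.keys_mult[of p q] by blast
  then show "kys \<mu> \<subseteq> V"
    using assms Poly_Mapping.keys_add[of \<kappa> \<rho>] unfolding mp_vars_in_def by blast
qed

lemma mp_vars_in_one [simp]: "mp_vars_in V 1"
  by (simp add: mp_vars_in_def)

lemma mp_vars_in_zero [simp]: "mp_vars_in V 0"
  by (simp add: mp_vars_in_def)

lemma mp_vars_in_mConst [simp]: "mp_vars_in V (mConst c)"
  by (simp add: mp_vars_in_def mConst_def)

lemma mp_vars_in_mVar [simp]: "i \<in> V \<Longrightarrow> mp_vars_in V (mVar i)"
  by (simp add: mp_vars_in_def mVar_def)

lemma mp_vars_in_add: "mp_vars_in V p \<Longrightarrow> mp_vars_in V q \<Longrightarrow> mp_vars_in V (p + q)"
  using Poly_Mapping.keys_add[of p q] unfolding mp_vars_in_def by blast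

lemma mp_vars_in_diff:
  fixes p q :: "'a::ab_group_add mpoly"
  shows "mp_vars_in V p \<Longrightarrow> mp_vars_in V q \<Longrightarrow> mp_vars_in V (p - q)"
  using Poly_Mapping.keys_add[of p "- q"] by (auto simp: mp_vars_in_def in_keys_iff lookup_add)

lemma mp_vars_in_prod: "(\<And>a. a \<in> A \<Longrightarrow> mp_vars_in V (f a)) \<Longrightarrow> mp_vars_in V (\<Prod>a\<in>A. f a)"
  by (induction A rule: infinite_finite_induct) (auto intro: mp_vars_in_mult)

lemma mp_vars_in_sum: "(\<And>a. a \<in> A \<Longrightarrow> mp_vars_in V (f a)) \<Longrightarrow> mp_vars_in V (\<Sum>a\<in>A. f a)"
  by (induction A rule: infinite_finite_induct) (auto intro: mp_vars_in_add)

lemma mp_vars_in_power: "mp_vars_in V p \<Longrightarrow> mp_vars_in V (p ^ k)"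
  by (induction k) (auto intro: mp_vars_in_mult)

lemma mp_vars_in_mp_eval:
  assumes "mp_vars_in W p" "\<And>i. i \<in> W \<Longrightarrow> mp_vars_in V (v i)"
  shows "mp_vars_in V (mp_eval mConst v p)"
  unfolding mp_eval_def using assms
  by (intro mp_vars_in_sum mp_vars_in_mult mp_vars_in_prod mp_vars_in_power)
     (auto simp: mp_vars_in_def[of W])

section \<open>Monomials in the elementary symmetric polynomials\<close>

definition exp_ind :: "nat set \<Rightarrow> nat \<Rightarrow>\<^sub>0 nat" where
  "exp_ind S = (\<Sum>a\<in>S. Poly_Mapping.single a 1)"

lemma lookup_exp_ind: "finite S \<Longrightarrow> lkp (exp_ind S) j = (if j \<in> S then 1 else 0)"
  by (simp add: exp_ind_def lookup_sum lookup_single when_def)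

lemma exp_ind_inject: 
  assumes fin: "finite S" "finite T"
  shows "exp_ind S = exp_ind T \<longleftrightarrow> S = T"
proof
  assume eq: "exp_ind S = exp_ind T"
  have "j \<in> S \<longleftrightarrow> j \<in> T" for j
    using arg_cong[OF eq, of "\<lambda>\<mu>. lkp \<mu> j"] fin by (simp add: lookup_exp_ind split: if_splits)
  then show "S = T" by blast
qed simp

lemma esym_alt:
  "esym n i = (\<Sum>S\<in>{S. S \<subseteq> {..<n} \<and> card S = i}. Poly_Mapping.single (exp_ind S) 1)"
  unfolding esym_def exp_ind_def mVar_def
  by (intro sum.cong refl prod_single_one) (auto intro: finite_subset)

text \<open>The two exponents first differ at the least k < i missing from S, where the initial
  segment has 1 and S has 0.\<close>

lemma exp_ind_le:
  assumes "finite S" "card S = i"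
  shows "exp_ind S \<le> exp_ind {..<i}"
proof (cases "S = {..<i}")
  case False
  have "\<not> {..<i} \<subseteq> S"
    using False assms by (metis card_lessThan card_subset_eq)
  then have ex: "\<exists>k. k < i \<and> k \<notin> S" by auto
  define k where "k = (LEAST k. k < i \<and> k \<notin> S)"
  have k: "k < i" "k \<notin> S" using LeastI_ex[OF ex] unfolding k_def by auto
  have "j \<in> S" if "j < k" for j
    using not_less_Least[of j "\<lambda>k. k < i \<and> k \<notin> S"] that k unfolding k_def by auto
  then have "exp_ind S < exp_ind {..<i}"
    unfolding less_exponent_iff using k assms by (intro exI[of _ k]) (auto simp: lookup_exp_ind)
  then show ?thesis by simp
qed simp

lemma has_lead_esym:
  assumes "i \<le> n"
  shows "has_lead (esym n i) (exp_ind {..<i}) 1"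
proof -
  let ?F = "{S. S \<subseteq> {..<n} \<and> card S = i}"
  have fin: "finite S" if "S \<in> ?F" for S using that by (auto intro: finite_subset)
  have finF: "finite ?F" by (rule finite_subset[of _ "Pow {..<n}"]) auto
  have "lkp (esym n i) (exp_ind {..<i}) = (\<Sum>S\<in>?F. if S = {..<i} then 1 else 0)"
    unfolding esym_alt using fin
    by (auto simp: lookup_sum lookup_single when_def exp_ind_inject intro!: sum.cong
        simp del: sum.delta sum.delta')
  also have "\<dots> = 1" using finF assms by auto
  finally have "lkp (esym n i) (exp_ind {..<i}) = (1::'a)" .
  moreover have "\<nu> \<le> exp_ind {..<i}" if "\<nu> \<in> kys (esym n i :: 'a mpoly)" for \<nu>
  proof -
    have "\<nu> \<in> (\<Union>S\<in>?F. kys (Poly_Mapping.single (exp_ind S) (1::'a)))"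
      using that unfolding esym_alt by (rule subsetD[OF keys_sum_subset])
    then obtain S where "S \<in> ?F" "\<nu> = exp_ind S" by (auto split: if_splits)
    then show ?thesis using fin[of S] by (simp add: exp_ind_le)
  qed
  ultimately show ?thesis by (simp add: has_lead_def)
qed

text \<open>The leading exponent of the product of the \<open>esym n i\<close> raised to the powers
  \<nu>_i. Its entry at j is the tail sum of the \<nu>_i with j < i \<le> n.\<close>

definition lead_exp :: "nat \<Rightarrow> (nat \<Rightarrow>\<^sub>0 nat) \<Rightarrow> nat \<Rightarrow>\<^sub>0 nat" where
  "lead_exp n \<nu> = (\<Sum>i=1..n. \<Sum>_<lkp \<nu> i. exp_ind {..<i})"

lemma lookup_lead_exp: "lkp (lead_exp n \<nu>) j = (\<Sum>i=1..n. if j < i then lkp \<nu> i else 0)"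
  unfolding lead_exp_def lookup_sum by (intro sum.cong refl) (simp add: lookup_exp_ind)

text \<open>Tail sums determine their terms by consecutive differences; injectivity and surjectivity
  of \<open>lead_exp\<close> both rest on this.\<close>

lemma lookup_lead_exp_Suc:
  assumes "j < n"
  shows "lkp (lead_exp n \<nu>) j = lkp (lead_exp n \<nu>) (Suc j) + lkp \<nu> (Suc j)"
proof -
  have "lkp (lead_exp n \<nu>) j =
      (\<Sum>i=1..n. (if Suc j < i then lkp \<nu> i else 0) + (if i = Suc j then lkp \<nu> (Suc j) else 0))"
    unfolding lookup_lead_exp by (intro sum.cong refl) auto
  also have "\<dots> = lkp (lead_exp n \<nu>) (Suc j) + lkp \<nu> (Suc j)"
    using assms by (simp add: sum.distrib lookup_lead_exp)
  finally show ?thesis .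
qed

lemma lead_exp_inj:
  assumes "kys \<nu> \<subseteq> {1..n}" "kys \<nu>' \<subseteq> {1..n}" "lead_exp n \<nu> = lead_exp n \<nu>'"
  shows "\<nu> = \<nu>'"
proof (rule poly_mapping_eqI)
  fix i
  show "lkp \<nu> i = lkp \<nu>' i"
  proof (cases "i \<in> {1..n}")
    case True
    then obtain j where "i = Suc j" "j < n" by (cases i) auto
    then show ?thesis
      using lookup_lead_exp_Suc[of j n \<nu>] lookup_lead_exp_Suc[of j n \<nu>'] assms(3) by simp
  next
    case False
    then have "i \<notin> kys \<nu>" "i \<notin> kys \<nu>'" using assms by auto
    then show ?thesis by (simp add: in_keys_iff)
  qed
qed

lemma has_lead_monom_eval_esym:
  assumes "kys \<nu> \<subseteq> {1..n}"
  shows "has_lead (monom_eval (esym n) \<nu> :: 'a::comm_ring_1 mpoly) (lead_exp n \<nu>) 1"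
proof -
  have "monom_eval (esym n) \<nu> = (\<Prod>i=1..n. esym n i ^ lkp \<nu> i :: 'a mpoly)"
    by (rule monom_eval_superset) (use assms in auto)
  moreover have "has_lead (\<Prod>i=1..n. esym n i ^ lkp \<nu> i :: 'a mpoly) (lead_exp n \<nu>) (\<Prod>i=1..n. 1 ^ lkp \<nu> i)"
    unfolding lead_exp_def by (intro has_lead_prod has_lead_power has_lead_esym) auto
  ultimately show ?thesis by simp
qed

text \<open>Distinct monomials in the elementary symmetric polynomials have distinct leading
  exponents, so the largest of these occurs in one summand only and its coefficient
  survives.\<close>

lemma esym_algebraically_independent:
  fixes q :: "'a::comm_ring_1 mpoly"
  assumes "mp_vars_in {1..n} q" "mp_eval mConst (esym n) q = 0"
  shows "q = 0"
proof (rule ccontr)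
  assume "q \<noteq> 0"
  then have ne: "kys q \<noteq> {}" by simp
  have vars: "kys \<nu> \<subseteq> {1..n}" if "\<nu> \<in> kys q" for \<nu>
    using assms(1) that by (auto simp: mp_vars_in_def)
  have "Max (lead_exp n ` kys q) \<in> lead_exp n ` kys q"
    using ne by (intro Max_in) auto
  then obtain \<nu>0 where \<nu>0: "\<nu>0 \<in> kys q" "Max (lead_exp n ` kys q) = lead_exp n \<nu>0"
    by auto
  have summand: "lkp (mConst (lkp q \<nu>) * monom_eval (esym n) \<nu>) (lead_exp n \<nu>0)
      = (if \<nu> = \<nu>0 then lkp q \<nu>0 else 0)" if "\<nu> \<in> kys q" for \<nu>
  proof -
    have "has_lead (mConst (lkp q \<nu>)) 0 (lkp q \<nu>)"
      by (simp add: has_lead_def mConst_def)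
    from has_lead_mult[OF this has_lead_monom_eval_esym[OF vars[OF that]]]
    have L: "has_lead (mConst (lkp q \<nu>) * monom_eval (esym n) \<nu>) (lead_exp n \<nu>) (lkp q \<nu>)" by simp
    have "lead_exp n \<nu> \<le> lead_exp n \<nu>0"
      using that by (simp flip: \<nu>0(2))
    moreover have "lead_exp n \<nu> = lead_exp n \<nu>0 \<longleftrightarrow> \<nu> = \<nu>0"
      using lead_exp_inj[OF vars[OF that] vars[OF \<nu>0(1)]] by auto
    ultimately have "lead_exp n \<nu>0 \<notin> kys (mConst (lkp q \<nu>) * monom_eval (esym n) \<nu>)" if "\<nu> \<noteq> \<nu>0"
      using that L unfolding has_lead_def by (metis leD order_le_less)
    then show ?thesis
      using L by (auto simp: has_lead_def in_keys_iff)
  qed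
  have "0 = lkp (mp_eval mConst (esym n) q) (lead_exp n \<nu>0)"
    using assms(2) by simp
  also have "\<dots> = (\<Sum>\<nu>\<in>kys q. if \<nu> = \<nu>0 then lkp q \<nu>0 else 0)"
    unfolding mp_eval_alt lookup_sum by (intro sum.cong refl summand)
  also have "\<dots> = lkp q \<nu>0" using \<nu>0(1) by simp
  finally show False using \<nu>0(1) by (simp add: in_keys_iff)
qed

text \<open>Permuting variables pushes an exponent forward along \<sigma> (\<open>act\<close> in the
  proof). As \<sigma> is bijective, the only exponent sent to \<mu> is the pullback of
  \<mu>.\<close>

lemma lookup_mp_perm:
  assumes "bij \<sigma>"
  shows "lkp (mp_perm \<sigma> p) \<mu> = lkp p (Poly_Mapping.map_key \<sigma> \<mu>)"
proof -
  have inj: "inj \<sigma>" using assms by (rule bij_is_inj)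
  define act where "act \<nu> = (\<Sum>i\<in>kys \<nu>. Poly_Mapping.single (\<sigma> i) (lkp \<nu> i))" for \<nu> :: "nat \<Rightarrow>\<^sub>0 nat"
  have lk: "lkp (act \<nu>) (\<sigma> j) = lkp \<nu> j" for \<nu> j
    unfolding act_def lookup_sum using inj
    by (auto simp: lookup_single when_def inj_eq in_keys_iff)
  have eq: "act \<nu> = \<mu> \<longleftrightarrow> \<nu> = Poly_Mapping.map_key \<sigma> \<mu>" for \<nu>
  proof
    assume "act \<nu> = \<mu>"
    then show "\<nu> = Poly_Mapping.map_key \<sigma> \<mu>"
      by (intro poly_mapping_eqI) (auto simp: map_key.rep_eq[OF inj] lk)
  next
    assume *: "\<nu> = Poly_Mapping.map_key \<sigma> \<mu>"
    show "act \<nu> = \<mu>"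
    proof (rule poly_mapping_eqI)
      fix k
      obtain j where "k = \<sigma> j" using assms by (metis bij_pointE)
      then show "lkp (act \<nu>) k = lkp \<mu> k"
        using * by (simp add: lk map_key.rep_eq[OF inj])
    qed
  qed
  have me: "monom_eval (\<lambda>j. mVar (\<sigma> j)) \<nu> = (Poly_Mapping.single (act \<nu>) 1 :: 'a mpoly)" for \<nu>
    by (simp add: monom_eval_def mVar_power prod_single_one act_def)
  have "lkp (mp_perm \<sigma> p) \<mu> = (\<Sum>\<nu>\<in>kys p. if \<nu> = Poly_Mapping.map_key \<sigma> \<mu> then lkp p \<nu> else 0)"
    unfolding mp_perm_def mp_eval_alt me lookup_sum
    by (intro sum.cong refl) (auto simp: mConst_def mult_single lookup_single eq when_def)
  also have "\<dots> = lkp p (Poly_Mapping.map_key \<sigma> \<mu>)"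
    by (simp add: in_keys_iff)
  finally show ?thesis .
qed

lemma mp_perm_esym:
  assumes "\<sigma> permutes {..<n}"
  shows "mp_perm \<sigma> (esym n i) = esym n i"
proof -
  have inj: "inj \<sigma>" using assms by (rule permutes_inj)
  have "mp_perm \<sigma> (esym n i) = (\<Sum>S\<in>{S. S \<subseteq> {..<n} \<and> card S = i}. \<Prod>a\<in>\<sigma> ` S. mVar a)"
    unfolding esym_def
    by (simp add: mp_perm.hom_sum mp_perm.hom_prod prod.reindex inj_on_subset[OF inj])
  also have "\<dots> = esym n i"
    unfolding esym_def
  proof (rule sum.reindex_bij_betw[of "image \<sigma>"])
    show "bij_betw ((`) \<sigma>) {S. S \<subseteq> {..<n} \<and> card S = i} {S. S \<subseteq> {..<n} \<and> card S = i}"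
    proof (rule bij_betw_byWitness[of _ "image (inv_into UNIV \<sigma>)"])
      have *: "(`) \<tau> ` {S. S \<subseteq> {..<n} \<and> card S = i} \<subseteq> {S. S \<subseteq> {..<n} \<and> card S = i}"
        if "\<tau> permutes {..<n}" for \<tau>
        using permutes_image[OF that] permutes_inj[OF that]
        by (auto simp: card_image inj_on_subset)
      show "(`) \<sigma> ` {S. S \<subseteq> {..<n} \<and> card S = i} \<subseteq> {S. S \<subseteq> {..<n} \<and> card S = i}"
        "(`) (inv_into UNIV \<sigma>) ` {S. S \<subseteq> {..<n} \<and> card S = i} \<subseteq> {S. S \<subseteq> {..<n} \<and> card S = i}"
        using *[OF assms] *[OF permutes_inv[OF assms]] by auto
    qed (auto simp: image_comp permutes_inv_o[OF assms])
  qed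
  finally show ?thesis .
qed

text \<open>With infinitely many variables the order has the descending chain X_0 > X_1 > ..., so
  the variables must be bounded. Then exponents become lists of fixed length under the lexicographic
  order.\<close>

lemma wf_exponents:
  "wf {(\<mu>, \<nu> :: nat \<Rightarrow>\<^sub>0 nat). \<mu> < \<nu> \<and> kys \<mu> \<subseteq> {..<n} \<and> kys \<nu> \<subseteq> {..<n}}"
proof (rule wf_subset)
  let ?f = "\<lambda>\<mu> :: nat \<Rightarrow>\<^sub>0 nat. map (lkp \<mu>) [0..<n]"
  show "wf (inv_image (lexn less_than n) ?f)"
    by (intro wf_inv_image wf_lexn wf_less_than)
  show "{(\<mu>, \<nu>). \<mu> < \<nu> \<and> kys \<mu> \<subseteq> {..<n} \<and> kys \<nu> \<subseteq> {..<n}} \<subseteq> inv_image (lexn less_than n) ?f"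
  proof (clarsimp)
    fix \<mu> \<nu> :: "nat \<Rightarrow>\<^sub>0 nat"
    assume "\<mu> < \<nu>" and sub: "kys \<mu> \<subseteq> {..<n}" "kys \<nu> \<subseteq> {..<n}"
    then obtain k where k: "lkp \<mu> k < lkp \<nu> k" "\<forall>k'<k. lkp \<mu> k' = lkp \<nu> k'"
      by (auto simp: less_exponent_iff)
    have "k \<in> kys \<nu>" using k by (simp add: in_keys_iff)
    with sub have "k < n" by auto
    then have "[0..<n] = [0..<k] @ k # [Suc k..<n]"
      using upt_add_eq_append[of 0 k "n - k"] by (simp add: upt_conv_Cons)
    then have split: "?f \<kappa> = map (lkp \<kappa>) [0..<k] @ lkp \<kappa> k # map (lkp \<kappa>) [Suc k..<n]" for \<kappa>
      by simp
    have "map (lkp \<mu>) [0..<k] = map (lkp \<nu>) [0..<k]" using k by simp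
    then show "(?f \<mu>, ?f \<nu>) \<in> lexn less_than n"
      using k(1) split[of \<mu>] split[of \<nu>] \<open>k < n\<close> unfolding lexn_conv mem_Collect_eq case_prod_conv
      by (metis length_map length_upt diff_zero less_than_iff)
  qed
qed

lemma lead_exp_surj:
  assumes "kys \<mu> \<subseteq> {..<n}" "\<And>j. lkp \<mu> (Suc j) \<le> lkp \<mu> j"
  obtains \<nu> where "kys \<nu> \<subseteq> {1..n}" "lead_exp n \<nu> = \<mu>"
proof -
  \<comment> \<open>Consecutive differences invert the tail sums; the truncated subtraction is exact
    because \<mu> is weakly decreasing.\<close>
  define \<nu> where "\<nu> = (\<Sum>i=1..n. Poly_Mapping.single i (lkp \<mu> (i - 1) - lkp \<mu> i))"
  have lk: "lkp \<nu> i = (if i \<in> {1..n} then lkp \<mu> (i - 1) - lkp \<mu> i else 0)" for i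
    unfolding \<nu>_def lookup_sum by (simp add: lookup_single when_def)
  have "lkp (lead_exp n \<nu>) j = lkp \<mu> j" for j
  proof (cases "j \<le> n")
    case True
    then show ?thesis
    \<comment> \<open>The descent starts at n, where both sides vanish.\<close>
    proof (induction j rule: inc_induct)
      case base
      have "n \<notin> kys \<mu>" using assms by auto
      then show ?case by (simp add: lookup_lead_exp in_keys_iff)
    next
      case (step j)
      then show ?case using assms(2)[of j] by (simp add: lookup_lead_exp_Suc lk)
    qed
  next
    case False
    then have "j \<notin> kys \<mu>" using assms by auto
    then show ?thesis using False by (simp add: lookup_lead_exp in_keys_iff)
  qed
  then have "lead_exp n \<nu> = \<mu>" by (intro poly_mapping_eqI)
  moreover have "kys \<nu> \<subseteq> {1..n}" by (auto simp: in_keys_iff lk split: if_splits)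
  ultimately show ?thesis using that by blast
qed

text \<open>Gauss's reduction: the leading exponent of a symmetric polynomial is weakly decreasing,
  hence equals that of a monomial in the elementary symmetric polynomials. Subtracting the matching
  multiple leaves a symmetric polynomial with smaller leading exponent.\<close>

theorem symmetric_polynomial_esym:
  fixes p :: "'a::comm_ring_1 mpoly"
  assumes "mp_vars_in {..<n} p" "\<And>\<sigma>. \<sigma> permutes {..<n} \<Longrightarrow> mp_perm \<sigma> p = p"
  shows "\<exists>q. mp_vars_in {1..n} q \<and> mp_eval mConst (esym n) q = p"
proof -
  have main: "\<forall>p :: 'a mpoly. mp_vars_in {..<n} p \<longrightarrow> (\<forall>\<sigma>. \<sigma> permutes {..<n} \<longrightarrow> mp_perm \<sigma> p = p) \<longrightarrow>
     p \<noteq> 0 \<longrightarrow> Max (kys p) = \<mu> \<longrightarrow> (\<exists>q. mp_vars_in {1..n} q \<and> mp_eval mConst (esym n) q = p)" for \<mu>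
  proof (induction \<mu> rule: wf_induct_rule[OF wf_exponents[of n]])
    case (1 \<mu>)
    show ?case
    proof (intro allI impI)
      fix p :: "'a mpoly"
      assume vars: "mp_vars_in {..<n} p" and sym: "\<forall>\<sigma>. \<sigma> permutes {..<n} \<longrightarrow> mp_perm \<sigma> p = p"
        and nz: "p \<noteq> 0" and \<mu>: "Max (kys p) = \<mu>"
      have ne: "kys p \<noteq> {}" using nz by simp
      have \<mu>_in: "\<mu> \<in> kys p" using Max_in[OF finite_keys ne] \<mu> by simp
      have \<mu>_max: "\<nu> \<le> \<mu>" if "\<nu> \<in> kys p" for \<nu> using that \<mu> by auto
      have \<mu>_vars: "kys \<mu> \<subseteq> {..<n}" using vars \<mu>_in by (auto simp: mp_vars_in_def)
      have anti: "lkp \<mu> (Suc j) \<le> lkp \<mu> j" for j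
      proof (rule ccontr)
        assume less: "\<not> lkp \<mu> (Suc j) \<le> lkp \<mu> j"
        then have "Suc j \<in> kys \<mu>" by (simp add: in_keys_iff)
        then have j: "Suc j < n" using \<mu>_vars by auto
        \<comment> \<open>An ascent of \<mu> at j could be swapped away, and by symmetry the
          resulting larger exponent would also occur in p.\<close>
        let ?\<sigma> = "transpose j (Suc j)"
        have perm: "?\<sigma> permutes {..<n}" using j by (intro permutes_swap_id) auto
        let ?\<nu> = "Poly_Mapping.map_key ?\<sigma> \<mu>"
        have lk: "lkp ?\<nu> i = lkp \<mu> (?\<sigma> i)" for i
          by (simp add: map_key.rep_eq)
        have "lkp p ?\<nu> = lkp p \<mu>"
          using lookup_mp_perm[of ?\<sigma> p \<mu>] sym perm by (simp add: permutes_bij)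
        then have "?\<nu> \<in> kys p" using \<mu>_in by (simp add: in_keys_iff)
        moreover have "\<mu> < ?\<nu>"
          unfolding less_exponent_iff
          by (intro exI[of _ j]) (use less in \<open>auto simp: lk transpose_def\<close>)
        ultimately show False using \<mu>_max by (meson leD)
      qed
      obtain \<nu> where \<nu>: "kys \<nu> \<subseteq> {1..n}" "lead_exp n \<nu> = \<mu>"
        using lead_exp_surj[OF \<mu>_vars anti] by blast
      define c where "c = lkp p \<mu>"
      define q0 where "q0 = Poly_Mapping.single \<nu> c"
      define p0 where "p0 = mp_eval mConst (esym n) q0"
      have q0_vars: "mp_vars_in {1..n} q0"
        using \<nu>(1) by (auto simp: mp_vars_in_def q0_def split: if_splits)
      have p0_vars: "mp_vars_in {..<n} p0"
        unfolding p0_def esym_def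
        by (intro mp_vars_in_mp_eval[OF q0_vars] mp_vars_in_sum mp_vars_in_prod mp_vars_in_mVar) auto
      have p0_sym: "mp_perm \<sigma> p0 = p0" if "\<sigma> permutes {..<n}" for \<sigma>
        unfolding p0_def mp_perm.hom_mp_eval mp_perm_esym[OF that] by (simp add: mp_perm_def)
      have "has_lead (mConst c) 0 c" by (simp add: has_lead_def mConst_def)
      from has_lead_mult[OF this has_lead_monom_eval_esym[OF \<nu>(1)]]
      have p0_lead: "has_lead p0 \<mu> c"
        using \<nu>(2) by (simp add: p0_def q0_def mConst.mp_eval_single)
      define p1 where "p1 = p - p0"
      have p1_vars: "mp_vars_in {..<n} p1"
        unfolding p1_def by (intro mp_vars_in_diff vars p0_vars)
      have p1_sym: "mp_perm \<sigma> p1 = p1" if "\<sigma> permutes {..<n}" for \<sigma>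
        using that sym p0_sym by (simp add: p1_def mp_perm.hom_minus)
      have p1_less: "\<kappa> < \<mu>" if "\<kappa> \<in> kys p1" for \<kappa>
      proof -
        have "\<kappa> \<noteq> \<mu>"
          using that p0_lead by (auto simp: has_lead_def in_keys_iff p1_def lookup_minus c_def)
        moreover have "\<kappa> \<in> kys p \<or> \<kappa> \<in> kys p0"
          using that by (auto simp: in_keys_iff p1_def lookup_minus)
        ultimately show ?thesis
          using p0_lead \<mu>_max by (force simp: has_lead_def)
      qed
      have "\<exists>q1. mp_vars_in {1..n} q1 \<and> mp_eval mConst (esym n) q1 = p1"
      proof (cases "p1 = 0")
        case True
        then show ?thesis by (intro exI[of _ 0]) simp
      next
        case False
        then have M: "Max (kys p1) \<in> kys p1" by (intro Max_in) auto
        moreover have "kys (Max (kys p1)) \<subseteq> {..<n}"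
          using M p1_vars by (auto simp: mp_vars_in_def)
        ultimately have "(Max (kys p1), \<mu>) \<in> {(\<mu>, \<nu>). \<mu> < \<nu> \<and> kys \<mu> \<subseteq> {..<n} \<and> kys \<nu> \<subseteq> {..<n}}"
          using p1_less \<mu>_vars by auto
        from 1[OF this] show ?thesis using p1_vars p1_sym False by blast
      qed
      then obtain q1 where q1: "mp_vars_in {1..n} q1" "mp_eval mConst (esym n) q1 = p1" by blast
      have "mp_vars_in {1..n} (q0 + q1)" by (intro mp_vars_in_add q0_vars q1)
      moreover have "mp_eval mConst (esym n) (q0 + q1) = p"
        using q1(2) by (simp add: mConst.mp_eval_add p1_def flip: p0_def)
      ultimately show "\<exists>q. mp_vars_in {1..n} q \<and> mp_eval mConst (esym n) q = p" by blast
    qed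
  qed
  show ?thesis
  proof (cases "p = 0")
    case True
    then show ?thesis by (intro exI[of _ 0]) simp
  next
    case False
    then show ?thesis using main assms by blast
  qed
qed

section \<open>Circulant determinants and the polynomials $\Psi_m$\<close>

text \<open>Row k is the sequence x shifted cyclically by k places. Adding n first keeps the
  subtraction exact for k < n.\<close>

definition circ :: "nat \<Rightarrow> (nat \<Rightarrow> 'a) \<Rightarrow> 'a mat" where
  "circ n x = mat n n (\<lambda>(k, i). x ((i + n - k) mod n))"

lemma circ_carrier [simp]: "circ n x \<in> carrier_mat n n"
  by (simp add: circ_def)

lemma bij_betw_add_mod: "bij_betw (\<lambda>j. (j + k) mod n) {..<n} {..<n::nat}"
proof (cases "n = 0")
  case False
  have le: "a = b" if "a \<le> b" "b < n" "(a + k) mod n = (b + k) mod n" for a b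
  proof -
    have "n dvd (b + k) - (a + k)" using that by (metis add_le_mono1 mod_eq_dvd_iff_nat)
    then show ?thesis using that by (auto dest: dvd_imp_le)
  qed
  have "inj_on (\<lambda>j. (j + k) mod n) {..<n}"
    by (rule inj_onI) (metis le lessThan_iff linear)
  moreover have "(\<lambda>j. (j + k) mod n) ` {..<n} \<subseteq> {..<n}" using False by auto
  ultimately show ?thesis by (simp add: bij_betw_def endo_inj_surj)
qed (simp add: bij_betw_def)

text \<open>The columns of the Fourier matrix W are eigenvectors of every circulant, with
  eigenvalues g l, and W is nonsingular by orthogonality. The assumptions on w are exactly the
  orthogonality relations, so w may be a constant of a polynomial ring.\<close>

lemma det_circ:
  fixes x :: "nat \<Rightarrow> 'a::idom"
  assumes w: "w ^ n = 1" and zero_sum: "\<And>k. \<not> n dvd k \<Longrightarrow> (\<Sum>l<n. w ^ (l * k)) = 0"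
    and nz: "of_nat n \<noteq> (0 :: 'a)"
  shows "det (circ n x) = (\<Prod>l<n. \<Sum>j<n. w ^ (l * j) * x j)"
proof -
  define g where "g l = (\<Sum>j<n. w ^ (l * j) * x j)" for l
  define W where "W = mat n n (\<lambda>(i, l). w ^ (i * l))"
  \<comment> \<open>The exponent n - i stands for -i, because w has n-th power 1. Thus W' is the
    conjugate matrix and W * W' is n times the identity.\<close>
  define W' where "W' = mat n n (\<lambda>(l, i). w ^ (l * (n - i)))"
  define D where "D = mat n n (\<lambda>(k, l). if k = l then g l else 0)"
  have carr [simp]: "W \<in> carrier_mat n n" "W' \<in> carrier_mat n n" "D \<in> carrier_mat n n"
    by (auto simp: W_def W'_def D_def)
  have w_mod: "w ^ (a mod n * b) = w ^ (a * b)" for a b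
  proof -
    have "w ^ (a * b) = w ^ ((n * (a div n) + a mod n) * b)" by simp
    also have "\<dots> = (w ^ n) ^ (a div n * b) * w ^ (a mod n * b)"
      by (simp only: distrib_right power_add power_mult [symmetric] mult.assoc)
    finally show ?thesis using w by simp
  qed
  have "circ n x * W = W * D"
  proof (rule eq_matI)
    fix k l assume "k < dim_row (W * D)" "l < dim_col (W * D)"
    then have kl: "k < n" "l < n" by (auto simp: W_def D_def)
    have "(circ n x * W) $$ (k, l) = (\<Sum>i<n. x ((i + n - k) mod n) * w ^ (i * l))"
      using kl by (simp add: circ_def W_def scalar_prod_def atLeast0LessThan)
    also have "\<dots> = (\<Sum>j<n. x (((j + k) mod n + n - k) mod n) * w ^ ((j + k) mod n * l))"
      by (rule sum.reindex_bij_betw[OF bij_betw_add_mod, symmetric])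
    also have "\<dots> = (\<Sum>j<n. w ^ (k * l) * (w ^ (l * j) * x j))"
    proof (rule sum.cong[OF refl])
      fix j assume "j \<in> {..<n}"
      then have j: "j < n" by simp
      have "((j + k) mod n + n - k) mod n = ((j + k) mod n + (n - k)) mod n"
        using kl by simp
      also have "\<dots> = (j + k + (n - k)) mod n" by (rule mod_add_left_eq)
      also have "\<dots> = j" using j kl by simp
      finally have "((j + k) mod n + n - k) mod n = j" .
      moreover have "w ^ ((j + k) mod n * l) = w ^ (k * l) * w ^ (l * j)"
        unfolding w_mod by (simp add: algebra_simps flip: power_add)
      ultimately show "x (((j + k) mod n + n - k) mod n) * w ^ ((j + k) mod n * l)
          = w ^ (k * l) * (w ^ (l * j) * x j)"
        by (simp add: mult_ac)
    qed
    also have "\<dots> = w ^ (k * l) * g l"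
      by (simp add: g_def sum_distrib_left)
    also have "\<dots> = (\<Sum>i<n. w ^ (k * i) * (if i = l then g l else 0))"
      using kl by (simp add: if_distrib[of "\<lambda>y. _ * y"] cong: if_cong)
    also have "\<dots> = (W * D) $$ (k, l)"
      using kl by (simp add: D_def W_def scalar_prod_def atLeast0LessThan)
    finally show "(circ n x * W) $$ (k, l) = (W * D) $$ (k, l)" .
  qed (auto simp: circ_def W_def D_def)
  then have "det (circ n x) * det W = det W * det D"
    by (metis det_mult circ_carrier carr(1) carr(3))
  moreover have "det W \<noteq> 0"
  proof
    assume "det W = 0"
    have "W * W' = of_nat n \<cdot>\<^sub>m 1\<^sub>m n"
    proof (rule eq_matI)
      fix i i' assume "i < dim_row (of_nat n \<cdot>\<^sub>m 1\<^sub>m n :: 'a mat)" "i' < dim_col (of_nat n \<cdot>\<^sub>m 1\<^sub>m n :: 'a mat)"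
      then have i: "i < n" "i' < n" by auto
      have "(W * W') $$ (i, i') = (\<Sum>l<n. w ^ (i * l) * w ^ (l * (n - i')))"
        using i by (simp add: W_def W'_def scalar_prod_def atLeast0LessThan)
      also have "\<dots> = (\<Sum>l<n. w ^ (l * (i + (n - i'))))"
        by (simp add: distrib_left power_add mult_ac)
      also have "\<dots> = (if i = i' then of_nat n else 0)"
      proof (cases "i = i'")
        case True
        have "w ^ (l * n) = 1" for l
          using w by (metis mult.commute power_mult power_one)
        with True i show ?thesis by simp
      next
        case False
        have "\<not> n dvd i + (n - i')"
        proof
          assume "n dvd i + (n - i')"
          then obtain c where c: "i + (n - i') = n * c" by (auto simp: dvd_def)
          \<comment> \<open>Both indices are below n, so the sum lies strictly between 0 and 2 n;
            the only multiple of n there is n, which would give i = i'.\<close>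
          have "0 < n * c" "n * c < n * 2" using c i by linarith+
          then have "c = 1" by auto
          with c i False show False by simp
        qed
        with zero_sum False show ?thesis by simp
      qed
      finally show "(W * W') $$ (i, i') = (of_nat n \<cdot>\<^sub>m 1\<^sub>m n) $$ (i, i')"
        using i by simp
    qed (auto simp: W_def W'_def)
    then have "det W * det W' = of_nat n ^ n"
      by (metis carr(1) carr(2) det_mult det_one det_smult index_one_mat(3) mult.right_neutral)
    with \<open>det W = 0\<close> nz show False by simp
  qed
  ultimately have "det (circ n x) = det D" by (simp add: mult.commute)
  also have "det D = prod_list (diag_mat D)"
    by (rule det_upper_triangular[of _ n]) (auto simp: D_def)
  also have "\<dots> = (\<Prod>l<n. g l)"
    by (simp add: diag_mat_def D_def prod.list_conv_set_nth atLeast0LessThan)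
  finally show ?thesis unfolding g_def .
qed

section \<open>Complex roots of unity\<close>

lemma eps_power: "n > 0 \<Longrightarrow> eps n ^ k = cis (2 * pi * real k / real n)"
  by (simp add: eps_def cis_conv_exp exp_of_nat_mult [symmetric] mult_ac)

lemma eps_power_self: "n > 0 \<Longrightarrow> eps n ^ n = 1"
  by (simp add: eps_power)

lemma eps_power_mod: "n > 0 \<Longrightarrow> eps n ^ (k mod n) = eps n ^ k"
  by (metis eps_power_self div_mult_mod_eq mult.left_neutral power_add power_mult power_one mult.commute)

lemma eps_power_eq_1_iff:
  assumes "n > 0"
  shows "eps n ^ k = 1 \<longleftrightarrow> n dvd k"
proof
  assume "eps n ^ k = 1"
  then have "eps n ^ (k mod n) = eps n ^ 0" using assms by (simp add: eps_power_mod)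
  then have "cis (2 * pi * real (k mod n) / real n) = cis (2 * pi * real 0 / real n)"
    unfolding eps_power[OF assms] .
  moreover have "inj_on (\<lambda>k. cis (2 * pi * real k / real n)) {..<n}"
    using bij_betw_roots_unity[OF assms] by (simp add: bij_betw_def)
  ultimately have "k mod n = 0"
    using assms by (auto dest!: inj_onD simp del: of_nat_0)
  then show "n dvd k" by auto
next
  assume "n dvd k"
  then show "eps n ^ k = 1" using eps_power_self[OF assms] by (auto simp: power_mult)
qed

lemma sum_eps_power:
  assumes "n > 0" "\<not> n dvd k"
  shows "(\<Sum>l<n. eps n ^ (l * k)) = 0"
proof -
  have ne: "eps n ^ k \<noteq> 1" using assms by (simp add: eps_power_eq_1_iff)
  have "(\<Sum>l<n. eps n ^ (l * k)) = (\<Sum>l<n. (eps n ^ k) ^ l)"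
    by (simp add: power_mult [symmetric] mult.commute)
  also have "\<dots> = ((eps n ^ k) ^ n - 1) / (eps n ^ k - 1)"
    by (rule geometric_sum[OF ne])
  also have "(eps n ^ k) ^ n = 1"
    using eps_power_self[OF assms(1)] by (metis power_mult mult.commute power_one)
  finally show ?thesis by simp
qed

lemma eps_power_divisor:
  assumes "d dvd n" "n > 0"
  shows "eps n ^ (n div d) = eps d"
proof -
  obtain q where q: "n = d * q" using assms by (auto simp: dvd_def)
  then have "d > 0" "q > 0" using assms by auto
  then have "cis (2 * pi * real q / real (d * q)) = cis (2 * pi * real 1 / real d)"
    by simp
  then show ?thesis using q \<open>d > 0\<close> \<open>q > 0\<close> eps_power[of n q] eps_power[of d 1] by simp
qed

text \<open>These are the block sums of the partition into residue classes modulo d, which is one of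
  the partitions entering \<open>Theta n d\<close> when d divides n. For positive d the value is 0
  at every j \<ge> d.\<close>

definition residue_sum :: "nat \<Rightarrow> nat \<Rightarrow> (nat \<Rightarrow> 'a::comm_ring_1) \<Rightarrow> nat \<Rightarrow> 'a" where
  "residue_sum d n x j = (\<Sum>i\<in>{i\<in>{..<n}. i mod d = j}. x i)"

lemma (in comm_ring_hom) hom_residue_sum:
  "hom (residue_sum d n x j) = residue_sum d n (\<lambda>i. hom (x i)) j"
  by (simp add: residue_sum_def hom_sum)

lemma mp_eval_Psi:
  "mp_eval mConst v (Psi d)
     = (\<Prod>i\<in>{i\<in>{..<d}. coprime i d}. \<Sum>j<d. mConst (eps d ^ (i * j)) * v j)"
proof -
  interpret E: comm_ring_hom "mp_eval mConst v" by (rule mConst.comm_ring_hom_mp_eval)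
  show ?thesis by (simp add: Psi_def E.hom_prod E.hom_sum E.hom_mult)
qed

text \<open>The root of unity in front of x_j depends only on j modulo d, so the n terms can be
  collected by residue class.\<close>

lemma mp_eval_Psi_residue_sum:
  assumes "d > 0"
  shows "mp_eval mConst (residue_sum d n x) (Psi d)
     = (\<Prod>i\<in>{i\<in>{..<d}. coprime i d}. \<Sum>j<n. mConst (eps d ^ (i * j)) * x j)"
  unfolding mp_eval_Psi
proof (rule prod.cong[OF refl])
  fix i
  have e: "eps d ^ (i * (j mod d)) = eps d ^ (i * j)" for j
    using assms by (metis eps_power_mod mod_mult_right_eq)
  have "(\<Sum>j<d. mConst (eps d ^ (i * j)) * residue_sum d n x j)
      = (\<Sum>j<d. \<Sum>k\<in>{k\<in>{..<n}. k mod d = j}. mConst (eps d ^ (i * k)) * x k)"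
    unfolding residue_sum_def sum_distrib_left
    by (intro sum.cong refl) (use e in auto)
  also have "\<dots> = (\<Sum>j<n. mConst (eps d ^ (i * j)) * x j)"
    by (rule sum.group) (use assms in auto)
  finally show "(\<Sum>j<d. mConst (eps d ^ (i * j)) * residue_sum d n x j)
      = (\<Sum>j<n. mConst (eps d ^ (i * j)) * x j)" .
qed

text \<open>Each fraction l/n with l < n has a unique form i/d in lowest terms. The case l = 0
  corresponds to d = 1 and i = 0, which counts as coprime.\<close>

lemma bij_betw_lessThan_divisors:
  assumes "n > 0"
  shows "bij_betw (\<lambda>(d, i). n div d * i)
    (SIGMA d:{d. d dvd n}. {i\<in>{..<d}. coprime i d}) {..<n::nat}"
proof (rule bij_betw_byWitness[of _ "\<lambda>l. (n div gcd l n, l div gcd l n)"])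
  have gcd: "gcd (n div d * i) n = n div d" if "d dvd n" "coprime i d" for d i
  proof -
    have "gcd (n div d * i) n = gcd (n div d * i) (n div d * d)" using that by simp
    also have "\<dots> = n div d" using that by (subst gcd_mult_distrib_nat [symmetric]) simp
    finally show ?thesis .
  qed
  show "\<forall>a\<in>SIGMA d:{d. d dvd n}. {i\<in>{..<d}. coprime i d}.
      (\<lambda>l. (n div gcd l n, l div gcd l n)) (case a of (d, i) \<Rightarrow> n div d * i) = a"
    using assms by (auto simp: gcd div_div_eq_right dvd_div_eq_0_iff)
  show "\<forall>l\<in>{..<n}. (case (n div gcd l n, l div gcd l n) of (d, i) \<Rightarrow> n div d * i) = l"
    using assms by (auto simp: div_div_eq_right)
  show "(\<lambda>(d, i). n div d * i) ` (SIGMA d:{d. d dvd n}. {i\<in>{..<d}. coprime i d}) \<subseteq> {..<n}"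
  proof clarsimp
    fix d i assume "d dvd n" "i < d"
    then have "n div d * i < n div d * d"
      using assms by (intro mult_strict_left_mono) (auto simp: div_greater_zero_iff dvd_imp_le)
    then show "n div d * i < n" using \<open>d dvd n\<close> by simp
  qed
  show "(\<lambda>l. (n div gcd l n, l div gcd l n)) ` {..<n}
      \<subseteq> (SIGMA d:{d. d dvd n}. {i\<in>{..<d}. coprime i d})"
    using assms by (auto simp: div_less_mono div_gcd_coprime)
      (metis dvd_mult_div_cancel dvd_triv_right gcd_dvd2)
qed

lemma det_circ_mVar:
  assumes "n > 0"
  shows "det (circ n mVar) = (\<Prod>d\<in>{d. d dvd n}. mp_eval mConst (residue_sum d n mVar) (Psi d))"
proof -
  let ?w = "mConst (eps n)"
  let ?G = "\<lambda>l. \<Sum>j<n. mConst (eps n ^ (l * j)) * mVar j"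
  have "det (circ n mVar) = (\<Prod>l<n. \<Sum>j<n. ?w ^ (l * j) * mVar j)"
  proof (rule det_circ)
    show "?w ^ n = 1" using assms by (simp add: eps_power_self flip: mConst.hom_power)
    show "(\<Sum>l<n. ?w ^ (l * k)) = 0" if "\<not> n dvd k" for k
      using assms that by (simp add: sum_eps_power flip: mConst.hom_power mConst.hom_sum)
    show "of_nat n \<noteq> (0 :: complex mpoly)" using assms by simp
  qed
  also have "\<dots> = (\<Prod>l<n. ?G l)" by (simp flip: mConst.hom_power)
  also have "\<dots> = (\<Prod>(d, i)\<in>(SIGMA d:{d. d dvd n}. {i\<in>{..<d}. coprime i d}). ?G (n div d * i))"
    by (subst prod.reindex_bij_betw[OF bij_betw_lessThan_divisors[OF assms], symmetric])
       (simp add: case_prod_unfold)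
  also have "\<dots> = (\<Prod>d\<in>{d. d dvd n}. \<Prod>i\<in>{i\<in>{..<d}. coprime i d}. ?G (n div d * i))"
    using assms by (subst prod.Sigma) auto
  also have "\<dots> = (\<Prod>d\<in>{d. d dvd n}. mp_eval mConst (residue_sum d n mVar) (Psi d))"
  proof (rule prod.cong[OF refl])
    fix d assume "d \<in> {d. d dvd n}"
    then have d: "d dvd n" "d > 0" using assms by (auto intro: dvd_pos_nat)
    have "eps n ^ (n div d * i * j) = eps d ^ (i * j)" for i j
      using eps_power_divisor[OF d(1) assms] by (simp add: power_mult mult.assoc)
    then show "(\<Prod>i\<in>{i\<in>{..<d}. coprime i d}. ?G (n div d * i))
        = mp_eval mConst (residue_sum d n mVar) (Psi d)"
      by (simp add: mp_eval_Psi_residue_sum[OF d(2)])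
  qed
  finally show ?thesis .
qed

text \<open>X_0 is the largest variable and its coefficient is a zeroth power of a root of unity.
  This gives products of such forms leading coefficient 1.\<close>

lemma has_lead_linear_form:
  assumes "n > 0" "c 0 = 1"
  shows "has_lead (\<Sum>j<n. mConst (c j) * mVar j) (Poly_Mapping.single 0 1) 1"
proof -
  let ?L = "\<Sum>j<n. mConst (c j) * mVar j"
  have L: "?L = (\<Sum>j<n. Poly_Mapping.single (Poly_Mapping.single j 1) (c j))"
    by (simp add: mConst_def mVar_def mult_single)
  have lk: "lkp ?L (Poly_Mapping.single 0 1) = 1"
  proof -
    have "Poly_Mapping.single j (1::nat) = Poly_Mapping.single 0 1 \<longleftrightarrow> j = 0" for j :: nat
      by (metis lookup_single_eq lookup_single_not_eq one_neq_zero)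
    then show ?thesis
      unfolding L lookup_sum using assms by (simp add: lookup_single when_def)
  qed
  have "\<nu> \<le> Poly_Mapping.single 0 1" if "\<nu> \<in> kys ?L" for \<nu>
  proof -
    have "\<nu> \<in> (\<Union>j\<in>{..<n}. kys (Poly_Mapping.single (Poly_Mapping.single j (1::nat)) (c j)))"
      using that unfolding L by (rule subsetD[OF keys_sum_subset])
    then obtain j where j: "\<nu> = Poly_Mapping.single j 1" by (auto split: if_splits)
    have "\<nu> < Poly_Mapping.single 0 1" if "j \<noteq> 0"
      unfolding less_exponent_iff using that by (intro exI[of _ 0]) (auto simp: j lookup_single)
    then show ?thesis using j by (cases "j = 0") auto
  qed
  with lk show ?thesis by (simp add: has_lead_def)
qed

section \<open>Descent to integer coefficients\<close>

lemma mem_range_to_complex_iff: "p \<in> range to_complex \<longleftrightarrow> (\<forall>\<mu>. lkp p \<mu> \<in> \<int>)"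
  using range_to_complexI[of p] by (auto simp: lookup_to_complex)

text \<open>Split off the part q2 of q formed by its non-integral coefficients. Then p * q2 is still
  integral, yet its leading coefficient is that of q2, since p has leading coefficient 1; so q2 must
  be empty.\<close>

lemma range_to_complex_quotient:
  assumes pq: "p * q \<in> range to_complex" and p: "p \<in> range to_complex" and lead: "has_lead p \<mu> 1"
  shows "q \<in> range to_complex"
proof (rule ccontr)
  assume "q \<notin> range to_complex"
  define S where "S = {\<nu>. lkp q \<nu> \<notin> \<int>}"
  have "S \<subseteq> kys q" by (auto simp: S_def in_keys_iff)
  then have fin: "finite S" by (rule finite_subset) simp
  have ne: "S \<noteq> {}" using \<open>q \<notin> range to_complex\<close> by (auto simp: S_def mem_range_to_complex_iff)
  define q2 where "q2 = (\<Sum>\<nu>\<in>S. Poly_Mapping.single \<nu> (lkp q \<nu>))"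
  have lk2: "lkp q2 \<nu> = (if \<nu> \<in> S then lkp q \<nu> else 0)" for \<nu>
    unfolding q2_def lookup_sum using fin by (simp add: lookup_single when_def)
  define q1 where "q1 = q - q2"
  have "q1 \<in> range to_complex"
    by (auto simp: mem_range_to_complex_iff q1_def lookup_minus lk2 S_def)
  then obtain a b c where abc: "p * q = to_complex a" "p = to_complex b" "q1 = to_complex c"
    using pq p by auto
  have "p * q2 = to_complex (a - b * c)"
    using abc by (simp add: to_complex.hom_minus to_complex.hom_mult q1_def algebra_simps)
  then have int: "lkp (p * q2) \<nu> \<in> \<int>" for \<nu> by (simp add: lookup_to_complex)
  have "has_lead q2 (Max S) (lkp q (Max S))"
    using fin ne Max_in[OF fin ne] by (auto simp: has_lead_def lk2 in_keys_iff split: if_splits)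
  from has_lead_mult[OF lead this] have "lkp (p * q2) (\<mu> + Max S) = lkp q (Max S)"
    by (simp add: has_lead_def)
  with int[of "\<mu> + Max S"] Max_in[OF fin ne] show False by (simp add: S_def)
qed

lemma mp_eval_range_to_complex:
  assumes "p \<in> range to_complex" "\<And>i. v i \<in> range to_complex"
  shows "mp_eval mConst v p \<in> range to_complex"
proof -
  have w: "v i = to_complex (inv_into UNIV to_complex (v i))" for i
    using assms(2) by (simp add: f_inv_into_f)
  obtain q where "p = to_complex q" using assms(1) by auto
  then have "mp_eval mConst v p = to_complex (mp_eval mConst (\<lambda>i. inv_into UNIV to_complex (v i)) q)"
    by (simp add: to_complex_mp_eval flip: w)
  then show ?thesis by (metis rangeI)
qed

lemma Psi_integral: "n > 0 \<Longrightarrow> Psi n \<in> range to_complex"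
proof (induction n rule: less_induct)
  case (less n)
  let ?P = "\<lambda>d. mp_eval mConst (residue_sum d n mVar) (Psi d)"
  let ?D = "{d. d dvd n} - {n}"
  have vars: "residue_sum d n mVar i = to_complex (residue_sum d n mVar i)" for d i
    by (simp add: to_complex.hom_residue_sum)
  have D: "0 < d \<and> d < n" if "d \<in> ?D" for d
    using that less.prems by (auto intro: dvd_pos_nat dest: dvd_imp_le)
  \<comment> \<open>Residue classes modulo n are singletons, but \<open>residue_sum n n mVar\<close>
    vanishes beyond n and so differs from \<open>mVar\<close> as a function. The two product
    formulas are compared instead.\<close>
  have Pn: "?P n = Psi n"
  proof -
    have "?P n = mp_eval mConst mVar (Psi n)"
      by (rule trans[OF mp_eval_Psi_residue_sum[OF less.prems] mp_eval_Psi[symmetric]])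
    then show ?thesis by simp
  qed
  have "\<exists>f. \<forall>d\<in>?D. ?P d = to_complex (f d)"
  proof (rule bchoice, rule ballI)
    fix d assume "d \<in> ?D"
    then have "Psi d \<in> range to_complex" using D less.IH by blast
    then have "?P d \<in> range to_complex"
      by (rule mp_eval_range_to_complex) (metis vars rangeI)
    then show "\<exists>y. ?P d = to_complex y" by auto
  qed
  then obtain f where f: "\<And>d. d \<in> ?D \<Longrightarrow> ?P d = to_complex (f d)" by blast
  have "(\<Prod>d\<in>?D. ?P d) = to_complex (\<Prod>d\<in>?D. f d)"
    by (simp add: to_complex.hom_prod f)
  then have int: "(\<Prod>d\<in>?D. ?P d) \<in> range to_complex" by (metis rangeI)
  have "has_lead (?P d) (\<Sum>i\<in>{i\<in>{..<d}. coprime i d}. Poly_Mapping.single 0 1) (\<Prod>i\<in>{i\<in>{..<d}. coprime i d}. 1)"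
    if "d \<in> ?D" for d
    unfolding mp_eval_Psi_residue_sum[OF conjunct1[OF D[OF that]]]
    by (intro has_lead_prod has_lead_linear_form) (use less.prems in auto)
  then have "has_lead (\<Prod>d\<in>?D. ?P d) (\<Sum>d\<in>?D. \<Sum>i\<in>{i\<in>{..<d}. coprime i d}. Poly_Mapping.single 0 1)
      (\<Prod>d\<in>?D. \<Prod>i\<in>{i\<in>{..<d}. coprime i d}. 1)"
    using less.prems by (intro has_lead_prod) auto
  then have lead: "\<exists>\<mu>. has_lead (\<Prod>d\<in>?D. ?P d) \<mu> 1" by auto
  have "map_mat to_complex (circ n mVar) = circ n mVar"
    by (rule eq_matI) (auto simp: circ_def)
  then have "det (circ n mVar) = to_complex (det (circ n mVar))"
    by (metis to_complex.hom_det)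
  moreover have "det (circ n mVar) = (\<Prod>d\<in>?D. ?P d) * Psi n"
    using less.prems det_circ_mVar[of n] Pn
    by (simp add: prod.remove[of "{d. d dvd n}" n] mult.commute)
  ultimately have "(\<Prod>d\<in>?D. ?P d) * Psi n \<in> range to_complex" by (metis rangeI)
  then show ?case using int lead range_to_complex_quotient by blast
qed

definition PsiZ :: "nat \<Rightarrow> int mpoly" where
  "PsiZ m = (SOME p. to_complex p = Psi m)"

lemma to_complex_PsiZ:
  assumes "m > 0"
  shows "to_complex (PsiZ m) = Psi m"
proof -
  obtain p where "Psi m = to_complex p" using Psi_integral[OF assms] by blast
  then show ?thesis
    unfolding PsiZ_def by (intro someI[of "\<lambda>p. to_complex p = Psi m" p]) simp
qed

lemma comm_ring_hom_mp_eval_of_int: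
  "comm_ring_hom (mp_eval of_int x :: int mpoly \<Rightarrow> 'a::comm_ring_1)"
  by (rule comm_ring_hom.comm_ring_hom_mp_eval[OF comm_ring_hom_of_int])

lemma mp_eval_of_int_mp_eval:
  fixes x :: "nat \<Rightarrow> 'a::comm_ring_1"
  shows "mp_eval of_int x (mp_eval mConst v p) = mp_eval of_int (\<lambda>i. mp_eval of_int x (v i)) p"
proof -
  interpret I: comm_ring_hom "of_int :: int \<Rightarrow> 'a" by (rule comm_ring_hom_of_int)
  interpret E: comm_ring_hom "mp_eval of_int x :: int mpoly \<Rightarrow> 'a"
    by (rule comm_ring_hom_mp_eval_of_int)
  show ?thesis by (simp add: E.hom_mp_eval)
qed

lemma mp_eval_of_int_mVar [simp]: "mp_eval of_int x (mVar i) = (x i :: 'a::comm_ring_1)"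
  by (rule comm_ring_hom.mp_eval_mVar[OF comm_ring_hom_of_int])

text \<open>The identity is checked once, for indeterminates with integer coefficients, by passing
  to complex coefficients. Evaluation at x then specialises both sides.\<close>

theorem det_circ_PsiZ:
  fixes x :: "nat \<Rightarrow> 'a::comm_ring_1"
  assumes "n > 0"
  shows "det (circ n x) = (\<Prod>d\<in>{d. d dvd n}. mp_eval of_int (residue_sum d n x) (PsiZ d))"
proof -
  interpret E: comm_ring_hom "mp_eval of_int x :: int mpoly \<Rightarrow> 'a"
    by (rule comm_ring_hom_mp_eval_of_int)
  have "map_mat to_complex (circ n mVar) = circ n mVar"
    by (rule eq_matI) (auto simp: circ_def)
  then have "to_complex (det (circ n mVar)) = det (circ n mVar)"
    by (metis to_complex.hom_det)
  also have "\<dots> = (\<Prod>d\<in>{d. d dvd n}. mp_eval mConst (residue_sum d n mVar) (Psi d))"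
    by (rule det_circ_mVar[OF assms])
  also have "\<dots> = to_complex (\<Prod>d\<in>{d. d dvd n}. mp_eval mConst (residue_sum d n mVar) (PsiZ d))"
    using assms dvd_pos_nat[of n]
    by (auto simp: to_complex.hom_prod to_complex_mp_eval to_complex.hom_residue_sum to_complex_PsiZ
        intro!: prod.cong)
  finally have "det (circ n mVar) = (\<Prod>d\<in>{d. d dvd n}. mp_eval mConst (residue_sum d n mVar) (PsiZ d))"
    by (rule injD[OF inj_to_complex])
  then have "mp_eval of_int x (det (circ n mVar))
      = (\<Prod>d\<in>{d. d dvd n}. mp_eval of_int (residue_sum d n x) (PsiZ d))"
    by (simp add: E.hom_prod mp_eval_of_int_mp_eval E.hom_residue_sum)
  moreover have "map_mat (mp_eval of_int x) (circ n mVar) = circ n x"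
    by (rule eq_matI) (auto simp: circ_def)
  ultimately show ?thesis by (metis E.hom_det)
qed

section \<open>The polynomials $\Theta_{n,m}$ and $\theta_{n,m}$\<close>

lemma Sym_comp: "\<sigma> \<in> Sym m \<Longrightarrow> \<tau> \<in> Sym m \<Longrightarrow> \<sigma> \<circ> \<tau> \<in> Sym m"
  by (simp add: Sym_def permutes_compose)

lemma Sym_inv:
  assumes "\<sigma> \<in> Sym m"
  obtains \<sigma>' where "\<sigma>' \<in> Sym m" "\<sigma>' \<circ> \<sigma> = id" "\<sigma> \<circ> \<sigma>' = id"
  using assms permutes_inv permutes_inv_o unfolding Sym_def by blast

lemma id_in_Sym: "id \<in> Sym m"
  by (simp add: Sym_def permutes_id)

lemma finite_Sym: "finite (Sym m)"
  by (simp add: Sym_def finite_permutations)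

lemma mp_perm_inj:
  assumes "\<sigma> \<in> Sym m" "mp_perm \<sigma> p = mp_perm \<sigma> q"
  shows "p = q"
proof -
  obtain \<sigma>' where "\<sigma>' \<circ> \<sigma> = id" using Sym_inv[OF assms(1)] by blast
  then show ?thesis using arg_cong[OF assms(2), of "mp_perm \<sigma>'"] by (simp add: mp_perm_comp)
qed

definition Psi_orbit :: "nat \<Rightarrow> complex mpoly set" where
  "Psi_orbit m = (\<lambda>\<sigma>. mp_perm \<sigma> (Psi m)) ` Sym m"

lemma left_coset_eq:
  assumes "\<sigma> \<in> Sym m"
  shows "(\<lambda>\<tau>. \<sigma> \<circ> \<tau>) ` StabPsi m = {\<tau>\<in>Sym m. mp_perm \<tau> (Psi m) = mp_perm \<sigma> (Psi m)}"
proof (intro equalityI subsetI)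
  fix \<tau> assume "\<tau> \<in> (\<lambda>\<tau>. \<sigma> \<circ> \<tau>) ` StabPsi m"
  then show "\<tau> \<in> {\<tau>\<in>Sym m. mp_perm \<tau> (Psi m) = mp_perm \<sigma> (Psi m)}"
    using assms by (auto simp: StabPsi_def Sym_comp mp_perm_comp[symmetric])
next
  fix \<tau> assume \<tau>: "\<tau> \<in> {\<tau>\<in>Sym m. mp_perm \<tau> (Psi m) = mp_perm \<sigma> (Psi m)}"
  obtain \<sigma>' where \<sigma>': "\<sigma>' \<in> Sym m" "\<sigma>' \<circ> \<sigma> = id" "\<sigma> \<circ> \<sigma>' = id"
    using Sym_inv[OF assms] by blast
  have "mp_perm (\<sigma>' \<circ> \<tau>) (Psi m) = mp_perm \<sigma>' (mp_perm \<sigma> (Psi m))"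
    using \<tau> by (simp add: mp_perm_comp[symmetric])
  then have "\<sigma>' \<circ> \<tau> \<in> StabPsi m"
    using \<sigma>' \<tau> by (simp add: StabPsi_def Sym_comp mp_perm_comp)
  moreover have "\<tau> = \<sigma> \<circ> (\<sigma>' \<circ> \<tau>)" using \<sigma>' by (simp add: comp_assoc[symmetric])
  ultimately show "\<tau> \<in> (\<lambda>\<tau>. \<sigma> \<circ> \<tau>) ` StabPsi m" by blast
qed

text \<open>A left coset of the stabilizer consists of the permutations giving \<open>Psi m\<close>
  the same image, so cosets correspond to the distinct conjugates. The arbitrary representatives
  thereby disappear.\<close>

lemma Phi_eq_prod_orbit: "Phi m = \<Prod>(Psi_orbit m)"
proof -
  let ?F = "\<lambda>C. mp_perm (SOME \<sigma>. \<sigma> \<in> C) (Psi m)"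
  let ?C = "\<lambda>\<sigma>. {\<tau>\<in>Sym m. mp_perm \<tau> (Psi m) = mp_perm \<sigma> (Psi m)}"
  have cosets: "left_cosets_Stab m = ?C ` Sym m"
    unfolding left_cosets_Stab_def using left_coset_eq by blast
  have F: "?F (?C \<sigma>) = mp_perm \<sigma> (Psi m)" if "\<sigma> \<in> Sym m" for \<sigma>
  proof -
    have "(SOME \<tau>. \<tau> \<in> ?C \<sigma>) \<in> ?C \<sigma>" using that by (intro someI[of "\<lambda>\<tau>. \<tau> \<in> ?C \<sigma>" \<sigma>]) simp
    then show ?thesis by simp
  qed
  have "inj_on ?F (left_cosets_Stab m)"
    unfolding cosets by (intro inj_onI) (use F in fastforce)
  moreover have "?F ` left_cosets_Stab m = Psi_orbit m"
    unfolding cosets Psi_orbit_def image_image using F by (intro image_cong refl) simp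
  ultimately show ?thesis
    unfolding Phi_def by (metis (no_types, lifting) prod.reindex_cong)
qed

text \<open>The product runs over the set of conjugates, so each one counts once however many
  permutations produce it, as in \<open>Phi\<close>.\<close>

definition PhiZ :: "nat \<Rightarrow> int mpoly" where
  "PhiZ m = \<Prod>((\<lambda>\<sigma>. mp_perm \<sigma> (PsiZ m)) ` Sym m)"

lemma to_complex_PhiZ:
  assumes "m > 0"
  shows "to_complex (PhiZ m) = Phi m"
proof -
  let ?O = "(\<lambda>\<sigma>. mp_perm \<sigma> (PsiZ m)) ` Sym m"
  have "to_complex ` ?O = Psi_orbit m"
    by (simp add: image_image to_complex_mp_perm to_complex_PsiZ[OF assms] Psi_orbit_def)
  moreover have "to_complex (PhiZ m) = \<Prod>(to_complex ` ?O)"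
    unfolding PhiZ_def
    by (simp add: to_complex.hom_prod prod.reindex[OF inj_on_subset[OF inj_to_complex subset_UNIV]])
  ultimately show ?thesis by (simp add: Phi_eq_prod_orbit)
qed

lemma mp_perm_PhiZ:
  assumes "\<rho> \<in> Sym m"
  shows "mp_perm \<rho> (PhiZ m) = PhiZ m"
proof -
  let ?O = "(\<lambda>\<sigma>. mp_perm \<sigma> (PsiZ m)) ` Sym m"
  have "inj_on (mp_perm \<rho>) ?O" using mp_perm_inj[OF assms] by (intro inj_onI)
  moreover have "mp_perm \<rho> ` ?O \<subseteq> ?O"
    using assms by (auto simp: mp_perm_comp intro!: imageI Sym_comp)
  ultimately have "bij_betw (mp_perm \<rho>) ?O ?O"
    by (simp add: bij_betw_def endo_inj_surj finite_Sym)
  then have "(\<Prod>p\<in>?O. mp_perm \<rho> p) = \<Prod>?O"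
    by (rule prod.reindex_bij_betw)
  then show ?thesis by (simp add: PhiZ_def mp_perm.hom_prod)
qed

text \<open>Two enumerations of the blocks differ by a permutation of the indices, under which
  \<open>PhiZ m\<close> is invariant. This permits replacing the arbitrary choice in
  \<open>blocks_enum\<close> by any convenient enumeration.\<close>

lemma mp_eval_PhiZ_enum:
  fixes s :: "'c \<Rightarrow> 'a::comm_ring_1"
  assumes cf: "comm_ring_hom cf" and g: "bij_betw g {..<m} Q" and g': "bij_betw g' {..<m} Q"
  shows "mp_eval cf (\<lambda>j. if j < m then s (g j) else 0) (PhiZ m)
       = mp_eval cf (\<lambda>j. if j < m then s (g' j) else 0) (PhiZ m)"
proof -
  define \<rho> where "\<rho> j = (if j < m then inv_into {..<m} g' (g j) else j)" for j
  have "bij_betw (inv_into {..<m} g' \<circ> g) {..<m} {..<m}"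
    using g bij_betw_inv_into[OF g'] by (rule bij_betw_trans)
  then have "bij_betw \<rho> {..<m} {..<m}"
    by (rule bij_betw_cong[THEN iffD1, rotated]) (simp add: \<rho>_def)
  then have \<rho>: "\<rho> \<in> Sym m"
    unfolding Sym_def by (simp, intro bij_imp_permutes) (auto simp: \<rho>_def)
  have "(\<lambda>j. if j < m then s (g j) else 0) = (\<lambda>j. if \<rho> j < m then s (g' (\<rho> j)) else 0)"
  proof
    fix j
    show "(if j < m then s (g j) else 0) = (if \<rho> j < m then s (g' (\<rho> j)) else 0)"
    proof (cases "j < m")
      case True
      then have "g j \<in> g' ` {..<m}" using g g' by (auto simp: bij_betw_def)
      then have "g' (\<rho> j) = g j" using True by (simp add: \<rho>_def f_inv_into_f)
      moreover have "\<rho> j < m"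
        using \<open>bij_betw \<rho> {..<m} {..<m}\<close> True by (auto simp: bij_betw_def)
      ultimately show ?thesis using True by simp
    qed (simp add: \<rho>_def)
  qed
  then have "mp_eval cf (\<lambda>j. if j < m then s (g j) else 0) (PhiZ m)
      = mp_eval cf (\<lambda>j. if j < m then s (g' j) else 0) (mp_perm \<rho> (PhiZ m))"
    by (simp add: mp_eval_mp_perm[OF cf])
  then show ?thesis by (simp add: mp_perm_PhiZ[OF \<rho>])
qed

section \<open>Products over partitions\<close>

lemma bij_betw_blocks_enum:
  assumes "Q \<in> Partitions n m"
  shows "bij_betw (blocks_enum m Q) {..<m} Q"
proof -
  have "finite Q" using assms finite_elements[of "{..<n}" Q] by (simp add: Partitions_def)
  moreover have "card Q = m" using assms by (simp add: Partitions_def)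
  ultimately have "\<exists>g. bij_betw g {..<m} Q" by (metis card_lessThan finite_lessThan finite_same_card_bij)
  then show ?thesis unfolding blocks_enum_def by (rule someI_ex)
qed

lemma finite_Partitions: "finite (Partitions n m)"
  by (rule finite_subset[OF _ finitely_many_partition_on[of "{..<n}"]]) (auto simp: Partitions_def)

definition block_factor :: "nat \<Rightarrow> nat set set \<Rightarrow> int mpoly" where
  "block_factor m Q =
     mp_eval mConst (\<lambda>j. if j < m then (\<Sum>a\<in>blocks_enum m Q j. mVar a) else 0) (PhiZ m)"

definition ThetaZ :: "nat \<Rightarrow> nat \<Rightarrow> int mpoly" where
  "ThetaZ n m = (\<Prod>Q\<in>Partitions n m. block_factor m Q)"

lemma to_complex_ThetaZ:
  assumes "m > 0"
  shows "to_complex (ThetaZ n m) = Theta n m"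
proof -
  have "to_complex (if j < m then \<Sum>a\<in>A j. mVar a else 0) = (if j < m then \<Sum>a\<in>A j. mVar a else 0)"
    for j and A :: "nat \<Rightarrow> nat set"
    by (simp add: to_complex.hom_sum)
  then show ?thesis
    unfolding ThetaZ_def Theta_def block_factor_def
    by (simp add: to_complex.hom_prod to_complex_mp_eval to_complex_PhiZ[OF assms])
qed

lemma Partitions_image:
  assumes \<pi>: "\<pi> permutes {..<n}" and Q: "Q \<in> Partitions n m"
  shows "(`) \<pi> ` Q \<in> Partitions n m"
proof -
  have part: "partition_on {..<n} Q" using Q by (simp add: Partitions_def)
  have inj: "inj \<pi>" using \<pi> by (rule permutes_inj)
  have "{} \<notin> (`) \<pi> ` Q" using partition_onD3[OF part] by auto
  then have "partition_on {..<n} ((`) \<pi> ` Q)"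
    using partition_on_inj_image[OF part inj_on_subset[OF inj subset_UNIV]] permutes_image[OF \<pi>] by simp
  moreover have "card ((`) \<pi> ` Q) = card Q"
    using inj by (intro card_image) (simp add: inj_image_eq_iff inj_on_def)
  moreover have "card (\<pi> ` P) = card P" for P
    using inj by (intro card_image inj_on_subset[OF inj]) simp
  ultimately show ?thesis using Q by (auto simp: Partitions_def)
qed

text \<open>A permutation of the variables permutes the partitions. It need not carry the chosen
  enumeration of Q to the chosen one of its image, but \<open>mp_eval_PhiZ_enum\<close> absorbs the
  difference.\<close>

lemma mp_perm_ThetaZ:
  assumes \<pi>: "\<pi> permutes {..<n}"
  shows "mp_perm \<pi> (ThetaZ n m) = ThetaZ n m"
proof -
  have inj: "inj \<pi>" using \<pi> by (rule permutes_inj)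
  have factor: "mp_perm \<pi> (block_factor m Q) = block_factor m ((`) \<pi> ` Q)" if Q: "Q \<in> Partitions n m" for Q
  proof -
    have bij: "bij_betw (\<lambda>j. \<pi> ` blocks_enum m Q j) {..<m} ((`) \<pi> ` Q)"
      using bij_betw_trans[OF bij_betw_blocks_enum[OF Q], of "(`) \<pi>" "(`) \<pi> ` Q"] inj
      by (simp add: o_def bij_betw_def inj_on_def inj_image_eq_iff)
    have "mp_perm \<pi> (if j < m then (\<Sum>a\<in>A. mVar a) else 0 :: int mpoly)
        = (if j < m then (\<Sum>a\<in>\<pi> ` A. mVar a) else 0)" for j A
      by (simp add: mp_perm.hom_sum sum.reindex inj_on_subset[OF inj])
    moreover have "mp_perm \<pi> (mConst c) = mConst c" for c :: int
      by (simp add: mp_perm_def)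
    ultimately have "mp_perm \<pi> (block_factor m Q) =
        mp_eval mConst (\<lambda>j. if j < m then (\<Sum>a\<in>\<pi> ` blocks_enum m Q j. mVar a) else 0) (PhiZ m)"
      unfolding block_factor_def mp_perm.hom_mp_eval by simp
    also have "\<dots> = block_factor m ((`) \<pi> ` Q)"
      unfolding block_factor_def
      by (rule mp_eval_PhiZ_enum[OF comm_ring_hom_mConst bij bij_betw_blocks_enum[OF Partitions_image[OF \<pi> Q]],
            of "\<lambda>B. \<Sum>a\<in>B. mVar a"])
    finally show ?thesis .
  qed
  have "inj_on ((`) ((`) \<pi>)) (Partitions n m)"
    using inj by (auto intro!: inj_onI simp: inj_image_eq_iff inj_on_def)
  moreover have "(`) ((`) \<pi>) ` Partitions n m \<subseteq> Partitions n m"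
    using Partitions_image[OF \<pi>] by auto
  ultimately have "bij_betw ((`) ((`) \<pi>)) (Partitions n m) (Partitions n m)"
    by (simp add: bij_betw_def endo_inj_surj finite_Partitions)
  then have "(\<Prod>Q\<in>Partitions n m. block_factor m ((`) \<pi> ` Q)) = ThetaZ n m"
    unfolding ThetaZ_def by (rule prod.reindex_bij_betw)
  then show ?thesis by (simp add: ThetaZ_def mp_perm.hom_prod factor)
qed

lemma mp_vars_in_ThetaZ: "mp_vars_in {..<n} (ThetaZ n m)"
  unfolding ThetaZ_def block_factor_def
proof (rule mp_vars_in_prod)
  fix Q assume Q: "Q \<in> Partitions n m"
  show "mp_vars_in {..<n} (mp_eval mConst
      (\<lambda>j. if j < m then \<Sum>a\<in>blocks_enum m Q j. mVar a else 0) (PhiZ m))"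
  proof (rule mp_vars_in_mp_eval[of UNIV])
    fix j
    have "blocks_enum m Q j \<subseteq> {..<n}" if "j < m"
    proof -
      have "blocks_enum m Q j \<in> Q"
        using bij_betw_blocks_enum[OF Q] that by (auto simp: bij_betw_def)
      then show ?thesis using Q partition_onD1[of "{..<n}" Q] by (auto simp: Partitions_def)
    qed
    then show "mp_vars_in {..<n} (if j < m then \<Sum>a\<in>blocks_enum m Q j. mVar a else 0 :: int mpoly)"
      by (auto intro!: mp_vars_in_sum mp_vars_in_mVar)
  qed (simp add: mp_vars_in_def)
qed

lemma to_complex_esym: "to_complex (esym n i) = esym n i"
  by (simp add: esym_def to_complex.hom_sum to_complex.hom_prod)

text \<open>The defining equation over the complex numbers is pulled back to the integers along the
  injection \<open>to_complex\<close>. Existence is then the reduction of symmetric polynomials, and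
  uniqueness is algebraic independence.\<close>

lemma theta_spec:
  assumes "m > 0"
  shows "mp_vars_in {1..n} (theta n m)" "mp_eval mConst (esym n) (theta n m) = ThetaZ n m"
proof -
  have eq: "mp_eval (\<lambda>c. mConst (of_int c)) (esym n) p = Theta n m
      \<longleftrightarrow> mp_eval mConst (esym n) p = ThetaZ n m" for p
  proof -
    have "to_complex (mp_eval mConst (esym n) p) = mp_eval (\<lambda>c. mConst (of_int c)) (esym n) p"
      by (simp add: to_complex.hom_mp_eval to_complex_esym)
    then show ?thesis
      using to_complex_ThetaZ[OF assms, of n] inj_eq[OF inj_to_complex] by metis
  qed
  obtain q where q: "mp_vars_in {1..n} q" "mp_eval mConst (esym n) q = ThetaZ n m"
    using symmetric_polynomial_esym[OF mp_vars_in_ThetaZ mp_perm_ThetaZ] by blast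
  have "theta n m = q"
    unfolding theta_def
  proof (rule the_equality)
    show "mp_vars_in {1..n} q \<and> mp_eval (\<lambda>c. mConst (of_int c)) (esym n) q = Theta n m"
      using q eq by simp
    fix p assume p: "mp_vars_in {1..n} p \<and> mp_eval (\<lambda>c. mConst (of_int c)) (esym n) p = Theta n m"
    interpret E: comm_ring_hom "mp_eval mConst (esym n) :: int mpoly \<Rightarrow> _"
      by (rule mConst.comm_ring_hom_mp_eval)
    have "mp_eval mConst (esym n) (p - q) = 0"
      using p q eq by (simp add: E.hom_minus)
    then have "p - q = 0"
      by (rule esym_algebraically_independent[OF mp_vars_in_diff[OF conjunct1[OF p] q(1)]])
    then show "p = q" by simp
  qed
  with q show "mp_vars_in {1..n} (theta n m)" "mp_eval mConst (esym n) (theta n m) = ThetaZ n m"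
    by auto
qed

lemma residue_classes_in_Partitions:
  assumes "d dvd n" "n > 0"
  defines "B \<equiv> \<lambda>j. {i\<in>{..<n}. i mod d = j}"
  shows "B ` {..<d} \<in> Partitions n d" "bij_betw B {..<d} (B ` {..<d})"
proof -
  have d: "d > 0" using assms dvd_pos_nat by blast
  have le: "d \<le> n" using assms dvd_imp_le by blast
  have j_in: "j \<in> B j" if "j < d" for j using that le by (auto simp: B_def)
  have inj: "inj_on B {..<d}"
  proof (rule inj_onI)
    fix j k assume "j \<in> {..<d}" "k \<in> {..<d}" "B j = B k"
    then have "j \<in> B k" using j_in[of j] by auto
    then show "j = k" using \<open>j \<in> {..<d}\<close> by (simp add: B_def)
  qed
  then show "bij_betw B {..<d} (B ` {..<d})" by (simp add: bij_betw_def)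
  have "partition_on {..<n} (B ` {..<d})"
  proof (rule partition_onI)
    show "\<Union>(B ` {..<d}) = {..<n}" using d by (auto simp: B_def)
    show "disjnt p q" if "p \<in> B ` {..<d}" "q \<in> B ` {..<d}" "p \<noteq> q" for p q
      using that by (auto simp: B_def disjnt_iff)
    show "{} \<notin> B ` {..<d}" using j_in by blast
  qed
  moreover have "card (B j) = n div d" if "j < d" for j
  proof -
    have "B j = (\<lambda>k. k * d + j) ` {..<n div d}"
    proof (intro equalityI subsetI)
      fix i assume i: "i \<in> B j"
      then have "i = (i div d) * d + j" using div_mult_mod_eq[of i d] by (auto simp: B_def)
      moreover have "i div d < n div d" using i assms(1) by (simp add: B_def less_mult_imp_div_less)
      ultimately show "i \<in> (\<lambda>k. k * d + j) ` {..<n div d}" by blast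
    next
      fix i assume "i \<in> (\<lambda>k. k * d + j) ` {..<n div d}"
      then obtain k where k: "k < n div d" "i = k * d + j" by auto
      then have "Suc k * d \<le> n div d * d" by (intro mult_right_mono) auto
      then have "k * d + d \<le> n" using assms by simp
      then show "i \<in> B j" using k that by (simp add: B_def)
    qed
    moreover have "inj_on (\<lambda>k. k * d + j) {..<n div d}" using d by (auto intro: inj_onI)
    ultimately show ?thesis by (simp add: card_image)
  qed
  ultimately show "B ` {..<d} \<in> Partitions n d"
    using inj by (auto simp: Partitions_def card_image)
qed

text \<open>The partition into residue classes contributes one factor of \<open>ThetaZ n d\<close>,
  and the identity permutation contributes \<open>PsiZ d\<close> itself to \<open>PhiZ d\<close>. A
  single vanishing factor suffices.\<close>

lemma ThetaZ_eval_eq_0: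
  fixes x :: "nat \<Rightarrow> 'a::comm_ring_1"
  assumes "d dvd n" "n > 0" and zero: "mp_eval of_int (residue_sum d n x) (PsiZ d) = 0"
  shows "mp_eval of_int x (ThetaZ n d) = 0"
proof -
  let ?B = "\<lambda>j. {i\<in>{..<n}. i mod d = j}"
  let ?Q = "?B ` {..<d}"
  interpret E: comm_ring_hom "mp_eval of_int x :: int mpoly \<Rightarrow> 'a"
    by (rule comm_ring_hom_mp_eval_of_int)
  interpret R: comm_ring_hom "mp_eval of_int (residue_sum d n x) :: int mpoly \<Rightarrow> 'a"
    by (rule comm_ring_hom_mp_eval_of_int)
  have d: "d > 0" using assms dvd_pos_nat by blast
  have Q: "?Q \<in> Partitions n d" "bij_betw ?B {..<d} ?Q"
    using residue_classes_in_Partitions[OF assms(1,2)] by auto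
  have "mp_eval of_int x (if j < d then (\<Sum>a\<in>A j. mVar a) else 0)
      = (if j < d then (\<Sum>a\<in>A j. x a) else 0)" for j and A :: "nat \<Rightarrow> nat set"
    by (simp add: E.hom_sum)
  then have "mp_eval of_int x (block_factor d ?Q)
      = mp_eval of_int (\<lambda>j. if j < d then (\<Sum>a\<in>blocks_enum d ?Q j. x a) else 0) (PhiZ d)"
    by (simp only: block_factor_def mp_eval_of_int_mp_eval)
  also have "\<dots> = mp_eval of_int (\<lambda>j. if j < d then (\<Sum>a\<in>?B j. x a) else 0) (PhiZ d)"
    by (rule mp_eval_PhiZ_enum[OF comm_ring_hom_of_int bij_betw_blocks_enum[OF Q(1)] Q(2),
          of "\<lambda>B. \<Sum>a\<in>B. x a"])
  \<comment> \<open>Beyond d the residue class is empty, so its sum agrees with the default value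
    0.\<close>
  also have "(\<lambda>j. if j < d then (\<Sum>a\<in>?B j. x a) else 0) = residue_sum d n x"
  proof
    fix j
    have "?B j = {}" if "\<not> j < d" using that d by auto
    then show "(if j < d then (\<Sum>a\<in>?B j. x a) else 0) = residue_sum d n x j"
      unfolding residue_sum_def by (metis sum.empty)
  qed
  also have "mp_eval of_int (residue_sum d n x) (PhiZ d) = 0"
  proof -
    have "PsiZ d \<in> (\<lambda>\<sigma>. mp_perm \<sigma> (PsiZ d)) ` Sym d"
      using id_in_Sym[of d] by (metis image_eqI mp_perm_id)
    then have "\<exists>p\<in>(\<lambda>\<sigma>. mp_perm \<sigma> (PsiZ d)) ` Sym d. mp_eval of_int (residue_sum d n x) p = 0"
      using zero by blast
    then show ?thesis
      unfolding PhiZ_def R.hom_prod using finite_Sym by (intro prod_zero) auto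
  qed
  finally have "mp_eval of_int x (block_factor d ?Q) = 0" .
  then show ?thesis
    unfolding ThetaZ_def E.hom_prod using Q(1) finite_Partitions by (intro prod_zero) auto
qed

text \<open>In an integral domain a vanishing circulant determinant forces one of its factors to
  vanish. Prescribing a on {1..n} is enough because \<open>theta n d\<close> involves only these
  variables.\<close>

theorem h_eval_eq_0:
  fixes x a :: "nat \<Rightarrow> 'a::idom"
  assumes "n > 0" "det (circ n x) = 0"
    and a: "\<And>i. i \<in> {1..n} \<Longrightarrow> a i = mp_eval of_int x (esym n i)"
  shows "mp_eval of_int a (h n) = 0"
proof -
  have fin: "finite {d. d dvd n}" using assms by simp
  interpret A: comm_ring_hom "mp_eval of_int a :: int mpoly \<Rightarrow> 'a"
    by (rule comm_ring_hom_mp_eval_of_int)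
  obtain d where d: "d dvd n" "mp_eval of_int (residue_sum d n x) (PsiZ d) = 0"
    using assms(2) fin unfolding det_circ_PsiZ[OF assms(1)] by auto
  have "d > 0" using d assms dvd_pos_nat by blast
  have "mp_eval of_int a (theta n d) = mp_eval of_int (\<lambda>i. mp_eval of_int x (esym n i)) (theta n d)"
    by (rule mp_eval_cong[OF theta_spec(1)[OF \<open>d > 0\<close>] a])
  also have "\<dots> = mp_eval of_int x (ThetaZ n d)"
    by (simp add: theta_spec(2)[OF \<open>d > 0\<close>, of n, symmetric] mp_eval_of_int_mp_eval)
  also have "\<dots> = 0" by (rule ThetaZ_eval_eq_0[OF d(1) assms(1) d(2)])
  finally show ?thesis
    unfolding h_def A.hom_prod using d fin by (intro prod_zero) auto
qed

section \<open>The fixed field of the Galois group\<close>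

definition poly_over :: "'a::zero set \<Rightarrow> 'a poly \<Rightarrow> bool" where
  "poly_over S p \<longleftrightarrow> (\<forall>i. coeff p i \<in> S)"

text \<open>A homomorphism defined on a subfield is a total function whose values elsewhere are
  unconstrained; extending it means agreeing with it on the smaller subfield.\<close>

definition hom_on :: "'a::field set \<Rightarrow> ('a \<Rightarrow> 'b::field) \<Rightarrow> bool" where
  "hom_on S \<phi> \<longleftrightarrow> \<phi> 1 = 1 \<and> (\<forall>x\<in>S. \<forall>y\<in>S. \<phi> (x + y) = \<phi> x + \<phi> y \<and> \<phi> (x * y) = \<phi> x * \<phi> y)"

lemma field_hom_iff_hom_on: "Defs.field_hom \<phi> \<longleftrightarrow> hom_on UNIV \<phi>"
  by (simp add: Defs.field_hom_def hom_on_def)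

section \<open>Polynomials with coefficients in a subfield\<close>

lemma is_subfield_UNIV: "is_subfield UNIV"
  by (simp add: is_subfield_def)

lemma subfield_sum:
  assumes "is_subfield S" "\<And>a. a \<in> A \<Longrightarrow> f a \<in> S"
  shows "(\<Sum>a\<in>A. f a) \<in> S"
  using assms by (induction A rule: infinite_finite_induct) (auto simp: is_subfield_def)

lemma poly_over_0: "is_subfield S \<Longrightarrow> poly_over S 0"
  by (simp add: poly_over_def is_subfield_def)

lemma poly_over_const: "is_subfield S \<Longrightarrow> c \<in> S \<Longrightarrow> poly_over S [:c:]"
  by (simp add: poly_over_def is_subfield_def coeff_pCons split: nat.splits)

lemma poly_over_X: "is_subfield S \<Longrightarrow> poly_over S [:0, 1:]"
  by (simp add: poly_over_def is_subfield_def coeff_pCons split: nat.splits)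

lemma poly_over_monom: "is_subfield S \<Longrightarrow> c \<in> S \<Longrightarrow> poly_over S (monom c n)"
  by (simp add: poly_over_def is_subfield_def)

lemma poly_over_add: "is_subfield S \<Longrightarrow> poly_over S p \<Longrightarrow> poly_over S q \<Longrightarrow> poly_over S (p + q)"
  by (simp add: poly_over_def is_subfield_def)

lemma poly_over_diff: "is_subfield S \<Longrightarrow> poly_over S p \<Longrightarrow> poly_over S q \<Longrightarrow> poly_over S (p - q)"
  by (simp add: poly_over_def is_subfield_def)

lemma poly_over_mult: "is_subfield S \<Longrightarrow> poly_over S p \<Longrightarrow> poly_over S q \<Longrightarrow> poly_over S (p * q)"
  unfolding poly_over_def coeff_mult
  by (intro allI subfield_sum) (auto simp: is_subfield_def)

lemma poly_over_division:
  assumes S: "is_subfield S" and q: "poly_over S q" "q \<noteq> 0"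
  shows "poly_over S p \<Longrightarrow> \<exists>a b. poly_over S a \<and> poly_over S b \<and> p = a * q + b \<and> (b = 0 \<or> degree b < degree q)"
\<comment> \<open>The zero polynomial shares degree 0 with the constants and needs a rank of its
  own, since cancelling a constant leads to it.\<close>
proof (induction "if p = 0 then 0 else Suc (degree p)" arbitrary: p rule: less_induct)
  case less
  show ?case
  proof (cases "p = 0 \<or> degree p < degree q")
    case True
    then show ?thesis using less.prems poly_over_0[OF S] by (intro exI[of _ 0] exI[of _ p]) auto
  next
    case False
    then have p0: "p \<noteq> 0" and le: "degree q \<le> degree p" by auto
    define c where "c = lead_coeff p * inverse (lead_coeff q)"
    define m where "m = monom c (degree p - degree q)"
    define p' where "p' = p - m * q"
    have "c \<in> S" using S q less.prems by (simp add: c_def poly_over_def is_subfield_def)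
    then have m: "poly_over S m" using S by (simp add: m_def poly_over_monom)
    then have p': "poly_over S p'"
      unfolding p'_def using S q less.prems by (intro poly_over_diff poly_over_mult)
    have "degree (m * q) \<le> (degree p - degree q) + degree q"
      unfolding m_def by (intro order.trans[OF degree_mult_le] add_right_mono degree_monom_le)
    then have "degree p' \<le> degree p"
      unfolding p'_def using le by (intro degree_diff_le) auto
    moreover have "coeff p' (degree p) = 0"
      using le q(2) by (simp add: p'_def m_def coeff_monom_mult c_def)
    ultimately have "p' = 0 \<or> degree p' < degree p"
      by (rule eq_zero_or_degree_less)
    then have "(if p' = 0 then 0 else Suc (degree p')) < (if p = 0 then 0 else Suc (degree p))"
      using p0 by auto
    from less.hyps[OF this p'] obtain a b where
      ab: "poly_over S a" "poly_over S b" "p' = a * q + b" "b = 0 \<or> degree b < degree q" by blast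
    have "p = (m + a) * q + b" using ab(3) by (simp add: p'_def algebra_simps)
    then show ?thesis using ab poly_over_add[OF S m ab(1)] by blast
  qed
qed

section \<open>Minimal polynomials and simple extensions\<close>

definition is_minpoly :: "'a::field set \<Rightarrow> 'a \<Rightarrow> 'a poly \<Rightarrow> bool" where
  "is_minpoly S r p \<longleftrightarrow> poly_over S p \<and> p \<noteq> 0 \<and> poly p r = 0 \<and>
     (\<forall>q. poly_over S q \<longrightarrow> poly q r = 0 \<longrightarrow> (\<exists>a. poly_over S a \<and> q = a * p))"

lemma minpoly_exists:
  assumes S: "is_subfield S" and g: "poly_over S g" "g \<noteq> 0" "poly g r = 0"
  shows "\<exists>p. is_minpoly S r p"
proof -
  let ?P = "\<lambda>p. poly_over S p \<and> p \<noteq> 0 \<and> poly p r = 0"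
  obtain p where p: "?P p" "\<And>q. ?P q \<Longrightarrow> degree p \<le> degree q"
    using ex_has_least_nat[of ?P g degree] g by blast
  have "\<exists>a. poly_over S a \<and> q = a * p" if q: "poly_over S q" "poly q r = 0" for q
  proof -
    obtain a b where ab: "poly_over S a" "poly_over S b" "q = a * p + b" "b = 0 \<or> degree b < degree p"
      using poly_over_division[OF S _ _ q(1), of p] p(1) by blast
    have "poly b r = 0" using ab(3) q(2) p(1) by simp
    then have "b = 0" using p(2)[of b] ab by (metis leD)
    then show ?thesis using ab by auto
  qed
  then show ?thesis using p(1) unfolding is_minpoly_def by blast
qed

lemma minpoly_degree_pos: "is_minpoly S r p \<Longrightarrow> degree p > 0"
  by (auto simp: is_minpoly_def elim!: degree_eq_zeroE intro!: gr0I)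

text \<open>Polynomial expressions suffice: for algebraic r they already form a field, as
  \<open>is_subfield_adjoin\<close> shows.\<close>

definition adjoin :: "'a::field set \<Rightarrow> 'a \<Rightarrow> 'a set" where
  "adjoin S r = {poly q r | q. poly_over S q}"

text \<open>This is Euclid's algorithm by descent on the degree of q. A q of large degree is
  replaced by its remainder modulo p; for small degree, dividing p by q gives a(r) q(r) = -b(r), and
  an inverse of b(r) yields one of q(r).\<close>

lemma adjoin_inverse:
  assumes S: "is_subfield S" and p: "is_minpoly S r p"
  shows "poly_over S q \<Longrightarrow> poly q r \<noteq> 0 \<Longrightarrow> \<exists>z. poly_over S z \<and> poly q r * poly z r = 1"
proof (induction "degree q" arbitrary: q rule: less_induct)
  case less
  have p': "poly_over S p" "p \<noteq> 0" "poly p r = 0" using p by (auto simp: is_minpoly_def)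
  have q0: "q \<noteq> 0" using less.prems by auto
  consider (const) "degree q = 0" | (big) "degree p \<le> degree q" "degree q > 0"
    | (small) "degree q < degree p" "degree q > 0" by linarith
  then show ?case
  proof cases
    case const
    then obtain c where c: "q = [:c:]" by (auto elim: degree_eq_zeroE)
    have "c \<in> S" using less.prems(1) c by (auto simp: poly_over_def dest: spec[of _ 0])
    then have "poly_over S [:inverse c:]" using S by (intro poly_over_const) (auto simp: is_subfield_def)
    then show ?thesis using c q0 by (intro exI[of _ "[:inverse c:]"]) auto
  next
    case big
    obtain a b where ab: "poly_over S a" "poly_over S b" "q = a * p + b" "b = 0 \<or> degree b < degree p"
      using poly_over_division[OF S p'(1,2) less.prems(1)] by blast
    have eq: "poly b r = poly q r" using ab(3) p' by simp
    then have "degree b < degree q" using ab(4) big less.prems by auto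
    then show ?thesis using less.hyps[of b] ab(2) eq less.prems by auto
  next
    case small
    obtain a b where ab: "poly_over S a" "poly_over S b" "p = a * q + b" "b = 0 \<or> degree b < degree q"
      using poly_over_division[OF S less.prems(1) q0 p'(1)] by blast
    have eq: "poly a r * poly q r = - poly b r" using ab(3) p'(3) by (metis add_eq_0_iff2 poly_add poly_mult)
    show ?thesis
    proof (cases "poly b r = 0")
      case False
      then have "degree b < degree q" using ab(4) by auto
      then obtain z where z: "poly_over S z" "poly b r * poly z r = 1"
        using less.hyps[of b] ab(2) False by blast
      have "poly q r * poly (0 - a * z) r = - (poly a r * poly q r) * poly z r" by simp
      also have "\<dots> = 1" using eq z by simp
      finally show ?thesis
        using ab(1) z(1) S by (intro exI[of _ "0 - a * z"] conjI poly_over_diff poly_over_0 poly_over_mult)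
    next
      case True
      \<comment> \<open>Now p divides both a and b. By degrees b = 0, so p = a * q with p dividing
        a, which contradicts the positive degree of q.\<close>
      then have "poly a r = 0" using eq less.prems(2) by simp
      then obtain a' where a': "a = a' * p" using p ab(1) unfolding is_minpoly_def by blast
      obtain b' where b': "b = b' * p" using p ab(2) True unfolding is_minpoly_def by blast
      have "b = 0"
      proof (rule ccontr)
        assume "b \<noteq> 0"
        then have "degree p \<le> degree b" using b' by (auto simp: degree_mult_eq)
        then show False using ab(4) small \<open>b \<noteq> 0\<close> by linarith
      qed
      then have "a \<noteq> 0" "degree p = degree a + degree q"
        using ab(3) p'(2) q0 by (auto simp: degree_mult_eq)
      moreover have "degree p \<le> degree a"
        using a' \<open>a \<noteq> 0\<close> by (auto simp: degree_mult_eq)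
      ultimately show ?thesis using small by simp
    qed
  qed
qed

lemma adjoin_subset: "is_subfield S \<Longrightarrow> S \<subseteq> adjoin S r"
  unfolding adjoin_def by (auto intro!: exI[of _ "[:_:]"] poly_over_const)

lemma adjoin_mem: "is_subfield S \<Longrightarrow> r \<in> adjoin S r"
  unfolding adjoin_def by (auto intro!: exI[of _ "[:0, 1:]"] poly_over_X)

lemma is_subfield_adjoin:
  assumes S: "is_subfield S" and p: "is_minpoly S r p"
  shows "is_subfield (adjoin S r)"
  unfolding is_subfield_def
proof (intro conjI ballI)
  show "0 \<in> adjoin S r" "1 \<in> adjoin S r"
    using adjoin_subset[OF S, of r] S by (auto simp: is_subfield_def)
  fix x assume "x \<in> adjoin S r"
  then obtain q where q: "poly_over S q" "x = poly q r" by (auto simp: adjoin_def)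
  show "inverse x \<in> adjoin S r"
  proof (cases "x = 0")
    case True
    then show ?thesis using \<open>x \<in> adjoin S r\<close> by simp
  next
    case False
    then obtain z where z: "poly_over S z" "x * poly z r = 1"
      using adjoin_inverse[OF S p q(1)] q(2) by auto
    then have "inverse x = poly z r" by (simp add: inverse_unique)
    then show ?thesis using z(1) by (auto simp: adjoin_def)
  qed
  fix y assume "y \<in> adjoin S r"
  then obtain q' where q': "poly_over S q'" "y = poly q' r" by (auto simp: adjoin_def)
  have "x + y = poly (q + q') r" "x - y = poly (q - q') r" "x * y = poly (q * q') r"
    using q q' by auto
  then show "x + y \<in> adjoin S r" "x - y \<in> adjoin S r" "x * y \<in> adjoin S r"
    unfolding adjoin_def using poly_over_add[OF S q(1) q'(1)] poly_over_diff[OF S q(1) q'(1)]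
      poly_over_mult[OF S q(1) q'(1)] by blast+
qed

section \<open>Homomorphisms on subfields and their extension\<close>

lemma hom_on_0:
  assumes "is_subfield S" "hom_on S \<phi>"
  shows "\<phi> 0 = 0"
proof -
  have "\<phi> (0 + 0) = \<phi> 0 + \<phi> 0" using assms unfolding hom_on_def is_subfield_def by blast
  then have "\<phi> 0 = \<phi> 0 + \<phi> 0" unfolding add_0_left .
  then show ?thesis by (rule add_cancel_right_right[THEN iffD1])
qed

lemma hom_on_diff:
  assumes "is_subfield S" "hom_on S \<phi>" "x \<in> S" "y \<in> S"
  shows "\<phi> (x - y) = \<phi> x - \<phi> y"
proof -
  have "x - y \<in> S" using assms by (simp add: is_subfield_def)
  then have "\<phi> (x - y + y) = \<phi> (x - y) + \<phi> y" using assms unfolding hom_on_def by blast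
  then show ?thesis by simp
qed

lemma hom_on_eq_0:
  assumes "is_subfield S" "hom_on S \<phi>" "x \<in> S" "\<phi> x = 0"
  shows "x = 0"
proof (rule ccontr)
  assume "x \<noteq> 0"
  have "inverse x \<in> S" using assms by (simp add: is_subfield_def)
  then have "\<phi> (x * inverse x) = \<phi> x * \<phi> (inverse x)" using assms unfolding hom_on_def by blast
  then show False using \<open>x \<noteq> 0\<close> assms by (simp add: hom_on_def)
qed

lemma hom_on_inj:
  assumes "is_subfield S" "hom_on S \<phi>"
  shows "inj_on \<phi> S"
proof (rule inj_onI)
  fix x y assume "x \<in> S" "y \<in> S" "\<phi> x = \<phi> y"
  then have "\<phi> (x - y) = 0" "x - y \<in> S"
    using assms by (auto simp: hom_on_diff is_subfield_def)
  then show "x = y" using hom_on_eq_0[OF assms, of "x - y"] by simp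
qed

lemma is_subfield_range:
  assumes "hom_on UNIV \<phi>"
  shows "is_subfield (range \<phi>)"
  unfolding is_subfield_def
proof (intro conjI ballI)
  note U = is_subfield_UNIV assms
  show "0 \<in> range \<phi>" using hom_on_0[OF U] by (metis rangeI)
  show "1 \<in> range \<phi>" using assms unfolding hom_on_def by (metis rangeI)
  fix x assume "x \<in> range \<phi>"
  then obtain x' where x': "x = \<phi> x'" by auto
  show "inverse x \<in> range \<phi>"
  proof (cases "x' = 0")
    case True
    then show ?thesis using x' hom_on_0[OF U] \<open>x \<in> range \<phi>\<close> by simp
  next
    case False
    have "\<phi> x' * \<phi> (inverse x') = \<phi> (x' * inverse x')" using assms by (simp add: hom_on_def)
    also have "\<dots> = 1" using False assms by (simp add: hom_on_def)
    finally have "inverse x = \<phi> (inverse x')" using x' by (simp add: inverse_unique)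
    then show ?thesis by simp
  qed
  fix y assume "y \<in> range \<phi>"
  then obtain y' where y': "y = \<phi> y'" by auto
  have "x + y = \<phi> (x' + y')" "x * y = \<phi> (x' * y')" "x - y = \<phi> (x' - y')"
    using x' y' assms hom_on_diff[OF U] by (auto simp: hom_on_def)
  then show "x + y \<in> range \<phi>" "x - y \<in> range \<phi>" "x * y \<in> range \<phi>" by auto
qed

lemma hom_on_sum:
  assumes S: "is_subfield S" "hom_on S \<phi>" and "\<And>a. a \<in> A \<Longrightarrow> f a \<in> S"
  shows "\<phi> (\<Sum>a\<in>A. f a) = (\<Sum>a\<in>A. \<phi> (f a))"
  using assms(3)
proof (induction A rule: infinite_finite_induct)
  case (insert a A)
  then have "(\<Sum>a\<in>A. f a) \<in> S" "f a \<in> S" using subfield_sum[OF S(1), of A f] by auto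
  then show ?case using insert S unfolding hom_on_def by simp
qed (auto simp: hom_on_0[OF S])

lemma coeff_map_poly_hom_on:
  "is_subfield S \<Longrightarrow> hom_on S \<phi> \<Longrightarrow> coeff (map_poly \<phi> p) i = \<phi> (coeff p i)"
  by (rule coeff_map_poly) (rule hom_on_0)

lemma map_poly_hom_on_add:
  assumes S: "is_subfield S" "hom_on S \<phi>" and "poly_over S p" "poly_over S q"
  shows "map_poly \<phi> (p + q) = map_poly \<phi> p + map_poly \<phi> q"
  using assms(3,4) S(2) by (intro poly_eqI) (simp add: coeff_map_poly_hom_on[OF S] poly_over_def hom_on_def)

lemma map_poly_hom_on_mult:
  assumes S: "is_subfield S" "hom_on S \<phi>" and pq: "poly_over S p" "poly_over S q"
  shows "map_poly \<phi> (p * q) = map_poly \<phi> p * map_poly \<phi> q"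
proof (rule poly_eqI)
  fix i
  have prod: "\<phi> (coeff p j * coeff q k) = \<phi> (coeff p j) * \<phi> (coeff q k)" "coeff p j * coeff q k \<in> S" for j k
    using S pq unfolding poly_over_def hom_on_def is_subfield_def by blast+
  show "coeff (map_poly \<phi> (p * q)) i = coeff (map_poly \<phi> p * map_poly \<phi> q) i"
    unfolding coeff_map_poly_hom_on[OF S] coeff_mult
    by (subst hom_on_sum[OF S]) (auto simp: prod)
qed

lemma poly_hom_on:
  assumes S: "is_subfield S" "hom_on S \<phi>" and "poly_over S p" "x \<in> S"
  shows "poly p x \<in> S \<and> \<phi> (poly p x) = poly (map_poly \<phi> p) (\<phi> x)"
  using assms(3)
proof (induction p)
  case 0
  then show ?case using S hom_on_0[OF S] by (simp add: is_subfield_def)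
next
  case (pCons a p)
  have a: "a \<in> S" and p: "poly_over S p"
    using pCons.prems unfolding poly_over_def by (metis coeff_pCons_0, metis coeff_pCons_Suc)
  have IH: "poly p x \<in> S" "\<phi> (poly p x) = poly (map_poly \<phi> p) (\<phi> x)" using pCons.IH[OF p] by auto
  have "x * poly p x \<in> S" using S assms(4) IH by (simp add: is_subfield_def)
  then show ?case
    using S a assms(4) IH pCons.hyps unfolding hom_on_def is_subfield_def
    by (simp add: map_poly_pCons hom_on_0[OF S])
qed

lemma degree_map_poly_hom_on:
  assumes S: "is_subfield S" "hom_on S \<phi>" and p: "poly_over S p"
  shows "degree (map_poly \<phi> p) = degree p"
proof (cases "p = 0")
  case False
  have "\<phi> (lead_coeff p) \<noteq> 0"
    using False p hom_on_eq_0[OF S] unfolding poly_over_def by (metis leading_coeff_0_iff)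
  then show ?thesis by (rule map_poly_degree_eq)
qed simp

text \<open>Sending r to s is well defined because two polynomials with the same value at r differ
  by a multiple of p, and the image of p vanishes at s.\<close>

lemma hom_on_adjoin:
  assumes S: "is_subfield S" "hom_on S \<phi>" and p: "is_minpoly S r p" and s: "poly (map_poly \<phi> p) s = 0"
  obtains \<phi>' where "hom_on (adjoin S r) \<phi>'" "\<And>x. x \<in> S \<Longrightarrow> \<phi>' x = \<phi> x"
    "\<And>q. poly_over S q \<Longrightarrow> \<phi>' (poly q r) = poly (map_poly \<phi> q) s"
proof -
  define rep where "rep y = (SOME q. poly_over S q \<and> poly q r = y)" for y
  define \<phi>' where "\<phi>' y = poly (map_poly \<phi> (rep y)) s" for y
  have rep: "poly_over S (rep (poly q r)) \<and> poly (rep (poly q r)) r = poly q r" if "poly_over S q" for q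
    unfolding rep_def by (rule someI[of "\<lambda>q'. poly_over S q' \<and> poly q' r = poly q r" q]) (simp add: that)
  have val: "\<phi>' (poly q r) = poly (map_poly \<phi> q) s" if q: "poly_over S q" for q
  proof -
    let ?q = "rep (poly q r)"
    have over: "poly_over S (q - ?q)" using rep[OF q] q by (intro poly_over_diff S) auto
    moreover have "poly (q - ?q) r = 0" using rep[OF q] by simp
    ultimately obtain a where a: "poly_over S a" "q - ?q = a * p"
      using p unfolding is_minpoly_def by blast
    have po: "poly_over S p" using p by (simp add: is_minpoly_def)
    have "q = ?q + a * p" using a(2) by (simp add: algebra_simps)
    then have "map_poly \<phi> q = map_poly \<phi> ?q + map_poly \<phi> a * map_poly \<phi> p"
      using map_poly_hom_on_add[OF S] map_poly_hom_on_mult[OF S a(1) po] rep[OF q] poly_over_mult[OF S(1) a(1) po]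
      by metis
    then show ?thesis using s by (simp add: \<phi>'_def)
  qed
  have const: "\<phi>' x = \<phi> x" if "x \<in> S" for x
    using val[OF poly_over_const[OF S(1) that]] hom_on_0[OF S] by (simp add: map_poly_pCons)
  have "hom_on (adjoin S r) \<phi>'"
    unfolding hom_on_def
  proof (intro conjI ballI)
    show "\<phi>' 1 = 1" using const[of 1] S by (simp add: is_subfield_def hom_on_def)
    fix x y assume "x \<in> adjoin S r" "y \<in> adjoin S r"
    then obtain q q' where q: "poly_over S q" "x = poly q r" "poly_over S q'" "y = poly q' r"
      by (auto simp: adjoin_def)
    have "\<phi>' (x + y) = poly (map_poly \<phi> (q + q')) s"
      using q val[OF poly_over_add[OF S(1) q(1,3)]] by simp
    then show "\<phi>' (x + y) = \<phi>' x + \<phi>' y"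
      using q by (simp add: map_poly_hom_on_add[OF S] val)
    have "\<phi>' (x * y) = poly (map_poly \<phi> (q * q')) s"
      using q val[OF poly_over_mult[OF S(1) q(1,3)]] by simp
    then show "\<phi>' (x * y) = \<phi>' x * \<phi>' y"
      using q by (simp add: map_poly_hom_on_mult[OF S] val)
  qed
  then show ?thesis using that const val by blast
qed

text \<open>A product has at most as many roots as its factors together, and each factor has at most
  its degree. If the product attains its degree, so does every factor.\<close>

lemma card_roots_factor:
  fixes g :: "'a::field poly"
  assumes "g = a * p" "g \<noteq> 0" "card {x. poly g x = 0} = degree g"
  shows "card {x. poly p x = 0} = degree p"
proof -
  have nz: "a \<noteq> 0" "p \<noteq> 0" using assms by auto
  have "degree g = card ({x. poly a x = 0} \<union> {x. poly p x = 0})"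
    using assms by (simp add: Collect_disj_eq flip: assms(3))
  also have "\<dots> \<le> card {x. poly a x = 0} + card {x. poly p x = 0}" by (rule card_Un_le)
  finally have "degree a + degree p \<le> card {x. poly a x = 0} + card {x. poly p x = 0}"
    using assms(1) nz by (simp add: degree_mult_eq)
  moreover have "card {x. poly a x = 0} \<le> degree a" "card {x. poly p x = 0} \<le> degree p"
    using nz by (auto intro: card_poly_roots_bound)
  ultimately show ?thesis by linarith
qed

text \<open>The condition \<open>card_roots\<close> says at once that g splits and that its roots
  are simple, and it is inherited by factors of g.\<close>

locale separable_splitting =
  fixes F :: "'a::field set" and g :: "'a poly"
  assumes F: "is_subfield F" and g: "poly_over F g" "g \<noteq> 0"
    and card_roots: "card {x. poly g x = 0} = degree g"
    and generated: "\<And>S. is_subfield S \<Longrightarrow> F \<subseteq> S \<Longrightarrow> {x. poly g x = 0} \<subseteq> S \<Longrightarrow> S = UNIV"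
begin

abbreviation "R \<equiv> {x. poly g x = 0}"

lemma finite_R: "finite R"
  using g(2) by (rule poly_roots_finite)

lemma poly_over_mono: "F \<subseteq> S \<Longrightarrow> poly_over S g"
  using g by (auto simp: poly_over_def)

lemma map_poly_g:
  assumes "\<And>x. x \<in> F \<Longrightarrow> \<phi> x = x"
  shows "map_poly \<phi> g = g"
proof (rule poly_eqI)
  have "\<phi> 0 = 0" using assms F by (simp add: is_subfield_def)
  then show "coeff (map_poly \<phi> g) i = coeff g i" for i
    using assms g by (simp add: coeff_map_poly poly_over_def)
qed

lemma minpoly_ex:
  assumes "is_subfield S" "F \<subseteq> S" "r \<in> R"
  obtains p a where "is_minpoly S r p" "poly_over S a" "g = a * p"
proof -
  obtain p where "is_minpoly S r p"
    using minpoly_exists[OF assms(1) poly_over_mono[OF assms(2)] g(2), of r] assms(3) by auto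
  then show ?thesis
    using that poly_over_mono[OF assms(2)] assms(3) unfolding is_minpoly_def by blast
qed

text \<open>The map permutes the finite root set, so its range is a subfield containing F and all
  roots, hence everything.\<close>

lemma aut_bij:
  assumes "hom_on UNIV \<phi>" "\<And>x. x \<in> F \<Longrightarrow> \<phi> x = x"
  shows "bij \<phi>"
proof -
  note U = is_subfield_UNIV assms(1)
  have inj: "inj \<phi>" by (rule hom_on_inj[OF U])
  have "poly g (\<phi> x) = \<phi> (poly g x)" for x
    using poly_hom_on[OF U, of g x] map_poly_g[OF assms(2)] by (simp add: poly_over_def)
  then have "\<phi> ` R \<subseteq> R" using hom_on_0[OF U] by auto
  then have "\<phi> ` R = R" using finite_R inj by (intro endo_inj_surj) (auto intro: inj_on_subset)
  then have "R \<subseteq> range \<phi>" by blast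
  moreover have "F \<subseteq> range \<phi>" using assms(2) by (metis rangeI subsetI)
  ultimately have "range \<phi> = UNIV" using is_subfield_range[OF assms(1)] by (intro generated)
  with inj show ?thesis by (simp add: bij_def)
qed

text \<open>Roots outside S are adjoined one at a time. A target for r exists because the image of
  its minimal polynomial divides the image of g, which is g, and g splits.\<close>

lemma extend_hom:
  assumes "is_subfield S" "F \<subseteq> S" "hom_on S \<phi>" "\<And>x. x \<in> F \<Longrightarrow> \<phi> x = x"
  shows "\<exists>\<sigma>. hom_on UNIV \<sigma> \<and> (\<forall>x\<in>S. \<sigma> x = \<phi> x)"
  using assms
proof (induction "card (R - S)" arbitrary: S \<phi> rule: less_induct)
  case less
  show ?case
  proof (cases "R \<subseteq> S")
    case True
    then have "S = UNIV" using less.prems by (intro generated)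
    then show ?thesis using less.prems by blast
  next
    case False
    then obtain r where r: "r \<in> R" "r \<notin> S" by blast
    obtain p a where pa: "is_minpoly S r p" "poly_over S a" "g = a * p"
      using minpoly_ex[OF less.prems(1,2) r(1)] by blast
    have po: "poly_over S p" using pa(1) by (simp add: is_minpoly_def)
    have "g = map_poly \<phi> (a * p)" using map_poly_g[OF less.prems(4)] pa(3) by simp
    then have "g = map_poly \<phi> a * map_poly \<phi> p"
      by (simp add: map_poly_hom_on_mult[OF less.prems(1,3) pa(2) po])
    then have "card {x. poly (map_poly \<phi> p) x = 0} = degree (map_poly \<phi> p)"
      by (rule card_roots_factor[OF _ g(2) card_roots])
    also have "\<dots> > 0"
      using minpoly_degree_pos[OF pa(1)] degree_map_poly_hom_on[OF less.prems(1,3) po] by simp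
    finally obtain s where s: "poly (map_poly \<phi> p) s = 0" by (auto simp: card_gt_0_iff)
    obtain \<phi>' where \<phi>': "hom_on (adjoin S r) \<phi>'" "\<And>x. x \<in> S \<Longrightarrow> \<phi>' x = \<phi> x"
      using hom_on_adjoin[OF less.prems(1,3) pa(1) s] by blast
    have sub: "S \<subseteq> adjoin S r" by (rule adjoin_subset[OF less.prems(1)])
    have "R - adjoin S r \<subset> R - S" using r sub adjoin_mem[OF less.prems(1), of r] by blast
    then have "card (R - adjoin S r) < card (R - S)" using finite_R by (intro psubset_card_mono) auto
    then have "\<exists>\<sigma>. hom_on UNIV \<sigma> \<and> (\<forall>x\<in>adjoin S r. \<sigma> x = \<phi>' x)"
      using less.hyps[OF _ is_subfield_adjoin[OF less.prems(1) pa(1)] _ \<phi>'(1)] sub \<phi>'(2) less.prems(2,4)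
      by (metis subset_iff)
    then show ?thesis using sub \<phi>'(2) by (metis subset_iff)
  qed
qed

text \<open>By induction y = q(r) with q over S of degree below that of the minimal polynomial p of
  r. For every root s of p some homomorphism over S sends r to s and fixes y, so q - y vanishes at
  all roots of p. There are as many of these as the degree of p, so q is the constant y.\<close>

lemma fixed_field:
  assumes "is_subfield S" "F \<subseteq> S"
    and "\<And>\<sigma>. hom_on UNIV \<sigma> \<Longrightarrow> (\<And>x. x \<in> S \<Longrightarrow> \<sigma> x = x) \<Longrightarrow> \<sigma> y = y"
  shows "y \<in> S"
  using assms
proof (induction "card (R - S)" arbitrary: S rule: less_induct)
  case less
  show ?case
  proof (cases "R \<subseteq> S")
    case True
    then have "S = UNIV" using less.prems by (intro generated)
    then show ?thesis by simp
  next
    case False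
    then obtain r where r: "r \<in> R" "r \<notin> S" by blast
    obtain p a where pa: "is_minpoly S r p" "poly_over S a" "g = a * p"
      using minpoly_ex[OF less.prems(1,2) r(1)] by blast
    have po: "poly_over S p" "p \<noteq> 0" "poly p r = 0" using pa(1) by (auto simp: is_minpoly_def)
    have sub: "S \<subseteq> adjoin S r" by (rule adjoin_subset[OF less.prems(1)])
    have "R - adjoin S r \<subset> R - S" using r sub adjoin_mem[OF less.prems(1), of r] by blast
    then have "card (R - adjoin S r) < card (R - S)" using finite_R by (intro psubset_card_mono) auto
    moreover have "\<sigma> y = y" if "hom_on UNIV \<sigma>" "\<And>x. x \<in> adjoin S r \<Longrightarrow> \<sigma> x = x" for \<sigma>
      using that sub by (intro less.prems(3)) auto
    ultimately have "y \<in> adjoin S r"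
      using less.hyps[OF _ is_subfield_adjoin[OF less.prems(1) pa(1)]] sub less.prems(2) by blast
    then obtain q0 where q0: "poly_over S q0" "y = poly q0 r" by (auto simp: adjoin_def)
    obtain b q where q: "poly_over S q" "q0 = b * p + q" "q = 0 \<or> degree q < degree p"
      using poly_over_division[OF less.prems(1) po(1,2) q0(1)] by blast
    have y: "y = poly q r" using q0 q po by simp
    have id: "hom_on S id" by (simp add: hom_on_def)
    have map_id: "map_poly id q' = q'" for q' :: "'a poly" by (simp add: map_poly_id)
    have root: "poly (q - [:y:]) s = 0" if s: "poly p s = 0" for s
    proof -
      obtain \<phi>' where \<phi>': "hom_on (adjoin S r) \<phi>'" "\<And>x. x \<in> S \<Longrightarrow> \<phi>' x = id x"
        "\<And>q. poly_over S q \<Longrightarrow> \<phi>' (poly q r) = poly (map_poly id q) s"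
        using hom_on_adjoin[OF less.prems(1) id pa(1), of s] s unfolding map_id by blast
      have "\<exists>\<sigma>. hom_on UNIV \<sigma> \<and> (\<forall>x\<in>adjoin S r. \<sigma> x = \<phi>' x)"
        using \<phi>' sub less.prems(2)
        by (intro extend_hom is_subfield_adjoin[OF less.prems(1) pa(1)]) auto
      then obtain \<sigma> where \<sigma>: "hom_on UNIV \<sigma>" "\<And>x. x \<in> adjoin S r \<Longrightarrow> \<sigma> x = \<phi>' x" by blast
      have "\<sigma> x = x" if "x \<in> S" for x using \<sigma>(2) \<phi>'(2) sub that by auto
      then have "\<sigma> y = y" using \<sigma>(1) less.prems(3) by blast
      moreover have "\<sigma> y = poly q s" using \<sigma>(2)[OF \<open>y \<in> adjoin S r\<close>] \<phi>'(3)[OF q(1)] y map_id by simp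
      ultimately show ?thesis by simp
    qed
    have "q = [:y:]"
    proof (rule ccontr)
      assume "q \<noteq> [:y:]"
      then have nz: "q - [:y:] \<noteq> 0" by simp
      have "degree p = card {x. poly p x = 0}"
        using card_roots_factor[OF pa(3) g(2) card_roots] by simp
      also have "\<dots> \<le> card {x. poly (q - [:y:]) x = 0}"
        using root nz by (intro card_mono poly_roots_finite) auto
      also have "\<dots> \<le> degree (q - [:y:])" using nz by (rule card_poly_roots_bound)
      also have "\<dots> < degree p"
        using q(3) minpoly_degree_pos[OF pa(1)] by (intro degree_diff_less) auto
      finally show False by simp
    qed
    then show ?thesis using q(1) unfolding poly_over_def by (metis coeff_pCons_0)
  qed
qed

end

section \<open>Normality\<close>

text \<open>Factors of the form X + x_k keep the formula free of signs; it is applied to the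
  negatives of the roots.\<close>

lemma coeff_prod_linear_esym:
  fixes x :: "nat \<Rightarrow> 'a::comm_ring_1"
  assumes "i \<le> n"
  shows "coeff (\<Prod>k<n. [:x k, 1:]) (n - i) = mp_eval of_int x (esym n i)"
proof -
  interpret E: comm_ring_hom "mp_eval of_int x :: int mpoly \<Rightarrow> 'a"
    by (rule comm_ring_hom_mp_eval_of_int)
  have const: "(\<Prod>k\<in>X. [:x k:]) = [:\<Prod>k\<in>X. x k:]" for X
    by (induction X rule: infinite_finite_induct) (auto simp: one_pCons)
  have "(\<Prod>k<n. [:x k, 1:]) = (\<Prod>k<n. [:x k:] + monom 1 1)"
    by (simp add: monom_altdef)
  also have "\<dots> = (\<Sum>X\<in>Pow {..<n}. (\<Prod>k\<in>X. [:x k:]) * (\<Prod>k\<in>{..<n} - X. monom 1 1))"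
    by (rule prod_add) simp
  also have "\<dots> = (\<Sum>X\<in>Pow {..<n}. monom (\<Prod>k\<in>X. x k) (n - card X))"
  proof (rule sum.cong[OF refl])
    fix X assume "X \<in> Pow {..<n}"
    then have "card ({..<n} - X) = n - card X" by (subst card_Diff_subset) (auto intro: finite_subset)
    then show "(\<Prod>k\<in>X. [:x k:]) * (\<Prod>k\<in>{..<n} - X. monom 1 1) = monom (\<Prod>k\<in>X. x k) (n - card X)"
      by (simp add: const monom_power smult_monom)
  qed
  finally have "coeff (\<Prod>k<n. [:x k, 1:]) (n - i)
      = (\<Sum>X\<in>Pow {..<n}. if n - card X = n - i then \<Prod>k\<in>X. x k else 0)"
    by (simp add: coeff_sum)
  also have "\<dots> = (\<Sum>X\<in>{X\<in>Pow {..<n}. n - card X = n - i}. \<Prod>k\<in>X. x k)"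
    by (rule sum.inter_filter[symmetric]) simp
  also have "{X\<in>Pow {..<n}. n - card X = n - i} = {X. X \<subseteq> {..<n} \<and> card X = i}"
  proof -
    \<comment> \<open>Truncated subtraction from n determines the cardinality because both
      \<open>card X\<close> and i are at most n.\<close>
    have "n - card X = n - i \<longleftrightarrow> card X = i" if "X \<subseteq> {..<n}" for X
      using card_mono[OF _ that] assms by auto
    then show ?thesis by auto
  qed
  also have "(\<Sum>X\<in>\<dots>. \<Prod>k\<in>X. x k) = mp_eval of_int x (esym n i)"
    by (simp add: esym_def E.hom_sum E.hom_prod)
  finally show ?thesis .
qed

lemma rsquarefree_prod_distinct:
  fixes g :: "'a::field poly"
  assumes "rsquarefree g" "g = Polynomial.smult c (\<Prod>r\<leftarrow>rs. [:- r, 1:])"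
  shows "distinct rs"
proof (rule ccontr)
  assume "\<not> distinct rs"
  then obtain xs ys zs y where rs: "rs = xs @ [y] @ ys @ [y] @ zs"
    using not_distinct_decomp by blast
  have "prod_list (map L rs) = L y ^ 2 * prod_list (map L (xs @ ys @ zs))" for L :: "'a \<Rightarrow> 'a poly"
    unfolding rs by (simp add: power2_eq_square mult_ac)
  from this[of "\<lambda>r. [:- r, 1:]"] have "[:- y, 1:] ^ 2 dvd g"
    unfolding assms(2) by (metis dvd_smult dvd_triv_left)
  then have "2 \<le> order y g"
    using assms(1) by (simp add: order_divides rsquarefree_def)
  then show False using assms(1) unfolding rsquarefree_def by (metis not_numeral_le_zero numeral_le_one_iff semiring_norm(69))
qed

lemma det_nonzero_solvable:
  fixes A :: "'a::field mat"
  assumes A: "A \<in> carrier_mat n n" and det: "det A \<noteq> 0" and w: "w \<in> carrier_vec n"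
  obtains v where "v \<in> carrier_vec n" "A *\<^sub>v v = w"
proof -
  let ?B = "inverse (det A) \<cdot>\<^sub>m adj_mat A"
  have adj: "adj_mat A \<in> carrier_mat n n" "A * adj_mat A = det A \<cdot>\<^sub>m 1\<^sub>m n"
    using adj_mat[OF A] by auto
  then have B: "?B \<in> carrier_mat n n" by simp
  have "A * ?B = inverse (det A) \<cdot>\<^sub>m (det A \<cdot>\<^sub>m 1\<^sub>m n)"
    using mult_smult_distrib[OF A adj(1)] adj(2) by simp
  also have "\<dots> = 1\<^sub>m n" by (rule eq_matI) (use det in auto)
  finally have "A *\<^sub>v (?B *\<^sub>v w) = w"
    using assoc_mult_mat_vec[OF A B w] w by simp
  then show ?thesis using that[of "?B *\<^sub>v w"] mult_mat_vec_carrier[OF B w] by blast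
qed

lemma det_nonzero_unique:
  fixes A :: "'a::field mat"
  assumes A: "A \<in> carrier_mat n n" and det: "det A \<noteq> 0"
    and uv: "u \<in> carrier_vec n" "v \<in> carrier_vec n" "A *\<^sub>v u = A *\<^sub>v v"
  shows "u = v"
proof -
  have "A *\<^sub>v (u - v) = 0\<^sub>v n"
    using A uv by (simp add: mult_minus_distrib_mat_vec[of _ n n])
  then have "u - v = 0\<^sub>v n"
    using det_0_iff_vec_prod_zero[OF A] det uv by (metis minus_carrier_vec)
  show ?thesis
  proof (rule eq_vecI)
    fix i assume "i < dim_vec v"
    then have "(u - v) $ i = 0" using \<open>u - v = 0\<^sub>v n\<close> uv by simp
    then show "u $ i = v $ i" using \<open>i < dim_vec v\<close> by simp
  qed (use uv in auto)
qed

section \<open>Cyclic automorphism groups and circulant systems\<close>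

lemma hom_on_funpow:
  fixes \<tau> :: "'a::field \<Rightarrow> 'a"
  shows "hom_on UNIV \<tau> \<Longrightarrow> hom_on UNIV (\<tau> ^^ k)"
  by (induction k) (auto simp: hom_on_def)

lemma is_subfield_fixed:
  assumes "hom_on UNIV \<sigma>"
  shows "is_subfield {x. \<sigma> x = x}"
proof -
  have "\<sigma> (inverse x) = inverse x" if "\<sigma> x = x" for x
  proof (cases "x = 0")
    case True
    then show ?thesis using that by simp
  next
    case False
    then have "x * \<sigma> (inverse x) = 1" using that assms unfolding hom_on_def
      by (metis UNIV_I right_inverse)
    then show ?thesis by (rule inverse_unique[symmetric])
  qed
  then show ?thesis
    using assms hom_on_0[OF is_subfield_UNIV assms] hom_on_diff[OF is_subfield_UNIV assms]
    by (auto simp: is_subfield_def hom_on_def)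
qed

text \<open>Row k of the circulant lists, up to sign, the images of the elements \<tau>^i(r) under
  \<tau>^(n-k), where n - k represents -k. Applying powers of \<tau> to a relation with fixed
  coefficients yields a kernel vector, which gives independence; spanning comes from solving for the
  conjugates of y.\<close>

lemma cyclic_normal_basis:
  fixes \<tau> :: "'a::field \<Rightarrow> 'a"
  assumes \<tau>: "hom_on UNIV \<tau>" and n: "n > 0" and order: "\<tau> ^^ n = id"
    and det: "det (circ n (\<lambda>i. - (\<tau> ^^ i) r)) \<noteq> 0"
  shows "(\<And>i. i < n \<Longrightarrow> \<tau> (c i) = c i) \<Longrightarrow> (\<Sum>i<n. c i * (\<tau> ^^ i) r) = 0 \<Longrightarrow> i < n \<Longrightarrow> c i = 0"
    and "\<exists>c. (\<forall>i<n. \<tau> (c i) = c i) \<and> y = (\<Sum>i<n. c i * (\<tau> ^^ i) r)"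
proof -
  let ?T = "\<lambda>m. \<tau> ^^ m"
  let ?M = "circ n (\<lambda>i. - ?T i r)"
  have T: "hom_on UNIV (?T m)" for m by (rule hom_on_funpow[OF \<tau>])
  have T_mult: "?T m (x * z) = ?T m x * ?T m z" for m x z using T[of m] by (simp add: hom_on_def)
  have T_sum: "?T m (\<Sum>i\<in>A. f i) = (\<Sum>i\<in>A. ?T m (f i))" for m A and f :: "nat \<Rightarrow> 'a"
    by (rule hom_on_sum[OF is_subfield_UNIV T]) simp
  have T_0: "?T m 0 = 0" for m by (rule hom_on_0[OF is_subfield_UNIV T])
  have row: "(?M *\<^sub>v vec n u) $ k = - (\<Sum>i<n. u i * ?T (n - k) (?T i r))" if "k < n" for u k
  proof -
    have "?T ((i + n - k) mod n) r = ?T (n - k) (?T i r)" for i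
    proof -
      have "?T ((i + n - k) mod n) r = ?T (i + n - k) r" by (rule funpow_mod_eq) (simp add: order)
      also have "\<dots> = ?T ((n - k) + i) r" using that by (simp add: add.commute)
      also have "\<dots> = ?T (n - k) (?T i r)" by (simp add: funpow_add)
      finally show ?thesis .
    qed
    then have "(?M *\<^sub>v vec n u) $ k = (\<Sum>i<n. - ?T (n - k) (?T i r) * u i)"
      using that by (simp add: circ_def scalar_prod_def atLeast0LessThan)
    then show ?thesis by (simp add: sum_negf mult.commute)
  qed
  show "c i = 0" if c: "\<And>i. i < n \<Longrightarrow> \<tau> (c i) = c i" and sum: "(\<Sum>i<n. c i * ?T i r) = 0" and i: "i < n"
    for c i
  proof -
    have Tc: "?T m (c i) = c i" if "i < n" for m i
      using c[OF that] by (induction m) auto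
    have "?M *\<^sub>v vec n c = 0\<^sub>v n"
    proof (rule eq_vecI)
      fix k assume "k < dim_vec (0\<^sub>v n :: 'a vec)"
      then have k: "k < n" by simp
      have "(\<Sum>i<n. c i * ?T (n - k) (?T i r)) = ?T (n - k) (\<Sum>i<n. c i * ?T i r)"
        unfolding T_sum T_mult using Tc by simp
      then show "(?M *\<^sub>v vec n c) $ k = 0\<^sub>v n $ k"
        using k by (simp add: row sum T_0)
    qed (simp add: circ_def)
    then have "vec n c = 0\<^sub>v n"
      using det_0_iff_vec_prod_zero[OF circ_carrier] det by (metis vec_carrier)
    then show ?thesis using i by (metis index_vec index_zero_vec(1))
  qed
  show "\<exists>c. (\<forall>i<n. \<tau> (c i) = c i) \<and> y = (\<Sum>i<n. c i * ?T i r)"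
  proof -
    let ?w = "vec n (\<lambda>k. - ?T (n - k) y)"
    obtain v where v: "v \<in> carrier_vec n" "?M *\<^sub>v v = ?w"
      using det_nonzero_solvable[OF circ_carrier det, of ?w] by auto
    define c where "c i = v $ i" for i
    have vc: "v = vec n c" using v(1) by (intro eq_vecI) (auto simp: c_def)
    have eqn: "(\<Sum>i<n. c i * ?T m (?T i r)) = ?T m y" if m: "0 < m" "m \<le> n" for m
    proof -
      have "- (\<Sum>i<n. c i * ?T (n - (n - m)) (?T i r)) = ?w $ (n - m)"
        using row[of "n - m" c] v(2) vc m by simp
      then show ?thesis using m by simp
    qed
    have "?M *\<^sub>v vec n (\<lambda>i. \<tau> (c i)) = ?w"
    proof (rule eq_vecI)
      fix k assume "k < dim_vec ?w"
      then have k: "k < n" by simp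
      \<comment> \<open>m is the cyclic predecessor of n - k in the range 1..n, so applying \<tau>
        to equation m gives the equation of row k. When n - k = 1 the predecessor wraps around to
        n.\<close>
      define m where "m = (if n - k = 1 then n else n - k - 1)"
      have m: "0 < m" "m \<le> n" using k by (auto simp: m_def)
      have shift: "\<tau> (?T m x) = ?T (n - k) x" for x
      proof (cases "n - k = 1")
        case True
        then show ?thesis by (simp add: m_def order)
      next
        case False
        then have "n - k = Suc m" using k by (auto simp: m_def)
        then show ?thesis by simp
      qed
      have "\<tau> (\<Sum>i<n. c i * ?T m (?T i r)) = (\<Sum>i<n. \<tau> (c i) * \<tau> (?T m (?T i r)))"
        using T_sum[of 1] T_mult[of 1] by simp
      then have "(\<Sum>i<n. \<tau> (c i) * ?T (n - k) (?T i r)) = ?T (n - k) y"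
        unfolding eqn[OF m] shift by simp
      then show "(?M *\<^sub>v vec n (\<lambda>i. \<tau> (c i))) $ k = ?w $ k" using k by (simp add: row)
    qed (simp add: circ_def)
    then have "?M *\<^sub>v vec n (\<lambda>i. \<tau> (c i)) = ?M *\<^sub>v v" using v(2) by (simp only:)
    then have "vec n (\<lambda>i. \<tau> (c i)) = v"
      by (rule det_nonzero_unique[OF circ_carrier det vec_carrier v(1)])
    then have "\<forall>i<n. \<tau> (c i) = c i" by (metis c_def index_vec)
    \<comment> \<open>Row 0 is the equation for m = n, and there the power of \<tau> is the
      identity.\<close>
    moreover have "y = (\<Sum>i<n. c i * ?T i r)"
      using eqn[of n] n by (simp add: order)
    ultimately show ?thesis by blast
  qed
qed

text \<open>Finiteness forces a repetition, and injectivity turns it into a return to r itself. N is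
  the least positive return time.\<close>

lemma funpow_orbit:
  fixes f :: "'a \<Rightarrow> 'a"
  assumes "inj f" "finite A" and "\<And>k. (f ^^ k) r \<in> A"
  obtains N where "N > 0" "(f ^^ N) r = r" "inj_on (\<lambda>i. (f ^^ i) r) {..<N}"
    "\<And>k. (f ^^ k) r \<in> (\<lambda>i. (f ^^ i) r) ` {..<N}"
proof -
  have inj: "inj (f ^^ k)" for k using assms(1) by (induction k) (auto intro: inj_compose)
  have period: "(f ^^ (j - i)) r = r" if "i < j" "(f ^^ i) r = (f ^^ j) r" for i j
  proof -
    have "(f ^^ i) ((f ^^ (j - i)) r) = (f ^^ i) r"
      using that by (metis add_diff_inverse_nat comp_apply funpow_add not_less_iff_gr_or_eq)
    then show ?thesis using inj injD by metis
  qed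
  have "\<not> inj (\<lambda>k. (f ^^ k) r)"
    using assms(2,3) by (metis finite_subset image_subsetI range_inj_infinite)
  then obtain i j where "i \<noteq> j" "(f ^^ i) r = (f ^^ j) r" by (auto simp: inj_on_def)
  then have ex: "\<exists>N. N > 0 \<and> (f ^^ N) r = r"
    using period[of i j] period[of j i] by (metis linorder_neqE_nat zero_less_diff)
  define N where "N = (LEAST N. N > 0 \<and> (f ^^ N) r = r)"
  have N: "N > 0" "(f ^^ N) r = r" using LeastI_ex[OF ex] by (auto simp: N_def)
  have least: "\<not> (f ^^ k) r = r" if "0 < k" "k < N" for k
    using not_less_Least[of k "\<lambda>N. N > 0 \<and> (f ^^ N) r = r"] that by (auto simp: N_def)
  have "inj_on (\<lambda>i. (f ^^ i) r) {..<N}"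
  proof (rule inj_onI)
    fix i j assume ij: "i \<in> {..<N}" "j \<in> {..<N}" "(f ^^ i) r = (f ^^ j) r"
    show "i = j"
    proof (rule linorder_cases[of i j])
      assume "i < j"
      then show ?thesis using period[of i j] least[of "j - i"] ij by (auto simp: less_imp_diff_less)
    next
      assume "j < i"
      then show ?thesis using period[of j i] least[of "i - j"] ij by (auto simp: less_imp_diff_less)
    qed
  qed
  moreover have "(f ^^ k) r \<in> (\<lambda>i. (f ^^ i) r) ` {..<N}" for k
    using funpow_mod_eq[OF N(2), of k] N(1) by (intro image_eqI[of _ _ "k mod N"]) auto
  ultimately show ?thesis using that N by blast
qed

lemma map_poly_hom_on_prod_linear:
  assumes "hom_on UNIV \<phi>"
  shows "map_poly \<phi> (\<Prod>s\<in>A. [:- s, 1:]) = (\<Prod>s\<in>A. [:- \<phi> s, 1:])"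
proof (induction A rule: infinite_finite_induct)
  case (insert s A)
  have "\<phi> (- s) = - \<phi> s"
    using hom_on_diff[OF is_subfield_UNIV assms, of 0 s] hom_on_0[OF is_subfield_UNIV assms] by simp
  then have "map_poly \<phi> [:- s, 1:] = [:- \<phi> s, 1:]"
    using hom_on_0[OF is_subfield_UNIV assms] assms by (simp add: map_poly_pCons hom_on_def)
  moreover have "map_poly \<phi> ([:- s, 1:] * (\<Prod>s\<in>A. [:- s, 1:]))
      = map_poly \<phi> [:- s, 1:] * map_poly \<phi> (\<Prod>s\<in>A. [:- s, 1:])"
    by (rule map_poly_hom_on_mult[OF is_subfield_UNIV assms]) (auto simp: poly_over_def)
  ultimately show ?case using insert by (simp only: prod.insert[OF insert.hyps])
qed (use assms hom_on_0[OF is_subfield_UNIV assms] in \<open>auto simp: hom_on_def map_poly_1'\<close>)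

context separable_splitting
begin

text \<open>The monic polynomial whose roots are the orbit of r is \<tau>-invariant, so it has
  coefficients in F and is divisible by the minimal polynomial of r. The orbit therefore has at
  least \<open>degree g\<close> elements and is all of R. The return power of \<tau> then fixes F
  and every root, hence everything.\<close>

lemma roots_eq_orbit:
  assumes \<tau>: "hom_on UNIV \<tau>" "\<And>x. x \<in> F \<Longrightarrow> \<tau> x = x" and fixed: "\<And>y. \<tau> y = y \<Longrightarrow> y \<in> F"
    and r: "r \<in> R" and irr: "\<And>p. is_minpoly F r p \<Longrightarrow> degree p = degree g"
  shows "bij_betw (\<lambda>i. (\<tau> ^^ i) r) {..<degree g} R" "\<tau> ^^ degree g = id"
proof -
  note U = is_subfield_UNIV \<tau>(1)
  have inj: "inj \<tau>" by (rule hom_on_inj[OF U])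
  have "poly g (\<tau> x) = \<tau> (poly g x)" for x
    using poly_hom_on[OF U, of g x] map_poly_g[OF \<tau>(2)] by (simp add: poly_over_def)
  then have step: "\<tau> x \<in> R" if "x \<in> R" for x using that hom_on_0[OF U] by auto
  have orb: "(\<tau> ^^ k) r \<in> R" for k using r step by (induction k) auto
  obtain N where N: "N > 0" "(\<tau> ^^ N) r = r" "inj_on (\<lambda>i. (\<tau> ^^ i) r) {..<N}"
    "\<And>k. (\<tau> ^^ k) r \<in> (\<lambda>i. (\<tau> ^^ i) r) ` {..<N}"
    using funpow_orbit[OF inj finite_R orb] by blast
  define Orb where "Orb = (\<lambda>i. (\<tau> ^^ i) r) ` {..<N}"
  have fin: "finite Orb" by (simp add: Orb_def)
  have "\<tau> ` Orb \<subseteq> Orb"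
  proof
    fix x assume "x \<in> \<tau> ` Orb"
    then obtain i where "x = (\<tau> ^^ Suc i) r" by (auto simp: Orb_def)
    then show "x \<in> Orb" using N(4)[of "Suc i"] by (simp add: Orb_def)
  qed
  then have bij: "bij_betw \<tau> Orb Orb"
    using endo_inj_surj[OF fin _ inj_on_subset[OF inj]] inj_on_subset[OF inj]
    by (simp add: bij_betw_def)
  define P where "P = (\<Prod>s\<in>Orb. [:- s, 1:])"
  have "map_poly \<tau> P = P"
    unfolding P_def map_poly_hom_on_prod_linear[OF \<tau>(1)]
    by (rule prod.reindex_bij_betw[OF bij, of "\<lambda>s. [:- s, 1:]"])
  then have "\<tau> (coeff P i) = coeff P i" for i using coeff_map_poly_hom_on[OF U] by metis
  then have "poly_over F P" using fixed by (simp add: poly_over_def)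
  have degP: "degree P = card Orb"
    unfolding P_def by (subst degree_prod_eq_sum_degree) auto
  have P0: "P \<noteq> 0" unfolding P_def using fin by auto
  have "r \<in> Orb" using N(4)[of 0] by (simp add: Orb_def)
  then have "poly P r = 0" unfolding P_def poly_prod using fin by (intro prod_zero) auto
  obtain p a where p: "is_minpoly F r p" using minpoly_ex[OF F _ r] by blast
  then obtain b where b: "P = b * p"
    using \<open>poly_over F P\<close> \<open>poly P r = 0\<close> unfolding is_minpoly_def by blast
  have "degree g \<le> degree P"
    using b P0 irr[OF p] by (auto simp: degree_mult_eq)
  then have "card R \<le> card Orb" using degP card_roots by simp
  moreover have sub: "Orb \<subseteq> R" using orb by (auto simp: Orb_def)
  ultimately have "Orb = R" using finite_R by (intro card_seteq) auto
  moreover have "card Orb = N" unfolding Orb_def using N(3) by (simp add: card_image)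
  ultimately have "N = degree g" using card_roots by simp
  then show "bij_betw (\<lambda>i. (\<tau> ^^ i) r) {..<degree g} R"
    using N(3) \<open>Orb = R\<close> by (simp add: bij_betw_def Orb_def)
  have TN: "hom_on UNIV (\<tau> ^^ N)" by (rule hom_on_funpow[OF \<tau>(1)])
  have "F \<subseteq> {x. (\<tau> ^^ N) x = x}"
  proof
    fix x assume "x \<in> F"
    then have "(\<tau> ^^ k) x = x" for k using \<tau>(2) by (induction k) auto
    then show "x \<in> {x. (\<tau> ^^ N) x = x}" by simp
  qed
  moreover have "R \<subseteq> {x. (\<tau> ^^ N) x = x}"
  proof
    fix x assume "x \<in> R"
    then obtain i where "x = (\<tau> ^^ i) r" using \<open>Orb = R\<close> by (auto simp: Orb_def)
    then have "(\<tau> ^^ N) x = (\<tau> ^^ (i + N)) r" by (metis add.commute comp_apply funpow_add)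
    then show "x \<in> {x. (\<tau> ^^ N) x = x}" using N(2) \<open>x = (\<tau> ^^ i) r\<close> by (simp add: funpow_add)
  qed
  ultimately have eq: "{x. (\<tau> ^^ N) x = x} = UNIV" using is_subfield_fixed[OF TN] by (intro generated)
  have "(\<tau> ^^ N) x = x" for x
    using UNIV_I[of x] unfolding eq[symmetric] by (rule CollectD)
  then show "\<tau> ^^ degree g = id" using \<open>N = degree g\<close> by (simp add: fun_eq_iff)
qed

end

text \<open>The factorisation of the image of f by the minimal polynomial pulls back along e to a
  factorisation of f, where irreducibility makes the cofactor a unit.\<close>

lemma minpoly_degree_irreducible:
  fixes f :: "'a::field poly" and e :: "'a \<Rightarrow> 'b::field"
  assumes e: "hom_on UNIV e" and irr: "irreducible f"
    and p: "is_minpoly (range e) r p" and r: "poly (map_poly e f) r = 0"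
  shows "degree p = degree f"
proof -
  note U = is_subfield_UNIV e
  have inj: "inj e" by (rule hom_on_inj[OF U])
  \<comment> \<open>\<open>map_poly\<close> acts coefficientwise only for functions that send 0 to
    0.\<close>
  have inv0: "inv_into UNIV e 0 = 0" using inj hom_on_0[OF U] by (metis inv_f_f)
  have lift: "\<exists>q0. map_poly e q0 = q" if "poly_over (range e) q" for q
    using that hom_on_0[OF U] inv0
    by (intro exI[of _ "map_poly (inv_into UNIV e) q"] poly_eqI)
       (simp add: coeff_map_poly poly_over_def f_inv_into_f)
  have "poly_over (range e) (map_poly e f)"
    using hom_on_0[OF U] by (simp add: poly_over_def coeff_map_poly)
  then obtain a where a: "poly_over (range e) a" "map_poly e f = a * p"
    using p r unfolding is_minpoly_def by blast
  have po: "poly_over (range e) p" using p by (simp add: is_minpoly_def)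
  obtain p0 a0 where 0: "map_poly e p0 = p" "map_poly e a0 = a" using lift[OF po] lift[OF a(1)] by blast
  have over: "poly_over UNIV q" for q :: "'a poly" by (simp add: poly_over_def)
  have "map_poly e f = map_poly e (a0 * p0)"
    using a(2) 0 by (simp add: map_poly_hom_on_mult[OF U over over])
  then have "e (coeff f i) = e (coeff (a0 * p0) i)" for i
    using coeff_map_poly_hom_on[OF U] by metis
  then have f: "f = a0 * p0" using inj by (intro poly_eqI) (auto dest: injD)
  have deg: "degree p = degree p0" using degree_map_poly_hom_on[OF U over, of p0] 0 by simp
  have nz: "f \<noteq> 0" using irr by auto
  have "\<not> p0 dvd 1"
    using minpoly_degree_pos[OF p] deg by (metis is_unit_iff_degree less_nat_zero_code dvd_0_left_iff zero_neq_one)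
  then have "a0 dvd 1" using irreducibleD[OF irr f] by blast
  then have "degree a0 = 0" using f nz by (subst (asm) is_unit_iff_degree) auto
  then show ?thesis using f nz deg by (auto simp: degree_mult_eq)
qed

theorem theorem3p3:
  fixes f :: "'a::field poly" and n :: nat and e :: "'a \<Rightarrow> 'b::field"
  assumes "n \<ge> 1"
    and "lead_coeff f = 1" and "degree f = n"
    and "is_splitting_field e f"
    and "rsquarefree (map_poly e f)"
    and "irreducible f"
    and "cyclic_fun_group (Gal e)"
    and "mp_eval of_int (\<lambda>i. coeff f (n - i)) (h n) \<noteq> 0"
  shows "let R = {x. poly (map_poly e f) x = 0} in
           (\<forall>c :: 'b \<Rightarrow> 'a. (\<Sum>r\<in>R. e (c r) * r) = 0 \<longrightarrow> (\<forall>r\<in>R. c r = 0)) \<and>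
           (\<forall>y. \<exists>c :: 'b \<Rightarrow> 'a. y = (\<Sum>r\<in>R. e (c r) * r))"
proof -
  have e: "hom_on UNIV e"
    using assms(4) by (simp add: is_splitting_field_def field_hom_iff_hom_on)
  note U = is_subfield_UNIV e
  have inj_e: "inj e" by (rule hom_on_inj[OF U])
  have e0: "e 0 = 0" by (rule hom_on_0[OF U])
  define g where "g = map_poly e f"
  have deg: "degree g = n"
    unfolding g_def using degree_map_poly_hom_on[OF U, of f] assms(3) by (simp add: poly_over_def)
  have lead: "lead_coeff g = 1"
    unfolding deg unfolding g_def coeff_map_poly_hom_on[OF U] using assms(2,3) e by (simp add: hom_on_def)
  have g0: "g \<noteq> 0" using lead by auto
  obtain c rs where g_split: "g = Polynomial.smult c (\<Prod>r\<leftarrow>rs. [:- r, 1:])"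
    using assms(4) unfolding is_splitting_field_def g_def by blast
  have "distinct rs" using rsquarefree_prod_distinct[OF _ g_split] assms(5) by (simp add: g_def)
  then have g_prod: "g = Polynomial.smult c (\<Prod>r\<in>set rs. [:- r, 1:])"
    using g_split by (simp add: prod.distinct_set_conv_list)
  have "lead_coeff g = c * lead_coeff (\<Prod>r\<in>set rs. [:- r, 1:])"
    unfolding g_prod by (rule lead_coeff_smult)
  then have "c = 1" using lead by (simp only: lead_coeff_prod) simp
  then have g_prod: "g = (\<Prod>r\<in>set rs. [:- r, 1:])" using g_prod by simp
  have roots: "{x. poly g x = 0} = set rs"
    unfolding g_prod poly_prod by auto
  have "degree g = card (set rs)"
    unfolding g_prod by (subst degree_prod_eq_sum_degree) auto
  then have card: "card {x. poly g x = 0} = degree g" using roots by simp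
  interpret separable_splitting "range e" g
  proof
    show "is_subfield (range e)" by (rule is_subfield_range[OF e])
    show "poly_over (range e) g" by (simp add: poly_over_def g_def coeff_map_poly_hom_on[OF U])
    show "S = UNIV" if "is_subfield S" "range e \<subseteq> S" "{x. poly g x = 0} \<subseteq> S" for S
      using assms(4) that unfolding is_splitting_field_def g_def by blast
  qed (use g0 card in auto)
  obtain \<tau> where \<tau>_Gal: "\<tau> \<in> Gal e" and cyc: "Gal e = {\<tau> ^^ k | k. True}"
    using assms(7) unfolding cyclic_fun_group_def by blast
  have \<tau>: "hom_on UNIV \<tau>" "\<And>x. x \<in> range e \<Longrightarrow> \<tau> x = x"
    using \<tau>_Gal by (auto simp: Gal_def field_hom_iff_hom_on)
  \<comment> \<open>Every automorphism over the base field is a power of \<tau>, so invariance under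
    \<tau> is invariance under all of them.\<close>
  have fixed: "y \<in> range e" if "\<tau> y = y" for y
  proof (rule fixed_field[OF is_subfield_range[OF e]])
    fix \<sigma> :: "'b \<Rightarrow> 'b" assume \<sigma>: "hom_on UNIV \<sigma>" "\<And>x. x \<in> range e \<Longrightarrow> \<sigma> x = x"
    then have "\<sigma> \<in> Gal e" using aut_bij[OF \<sigma>] by (simp add: Gal_def field_hom_iff_hom_on)
    then obtain k where "\<sigma> = \<tau> ^^ k" using cyc by auto
    moreover have "(\<tau> ^^ k) y = y" using that by (induction k) auto
    ultimately show "\<sigma> y = y" by simp
  qed simp
  have "card R > 0" using card deg assms(1) by simp
  then obtain r where r: "r \<in> R" by (metis card_gt_0_iff ex_in_conv)
  define b where "b i = (\<tau> ^^ i) r" for i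
  have bij: "bij_betw b {..<n} R" and order: "\<tau> ^^ n = id"
    using roots_eq_orbit[OF \<tau> fixed r] minpoly_degree_irreducible[OF e assms(6)] r deg assms(3)
    unfolding b_def g_def by auto
  have det: "det (circ n (\<lambda>i. - b i)) \<noteq> 0"
  proof
    assume zero: "det (circ n (\<lambda>i. - b i)) = 0"
    \<comment> \<open>Reading X - b_k as X + (-b_k) makes the coefficients of g elementary symmetric
      in the -b_k; this is why the circulant is built from the negatives.\<close>
    have g_b: "g = (\<Prod>k<n. [:- b k, 1:])"
      using prod.reindex_bij_betw[OF bij, of "\<lambda>s. [:- s, 1:]"] g_prod roots by simp
    have "mp_eval of_int (\<lambda>i. e (coeff f (n - i))) (h n) = 0"
    proof (rule h_eval_eq_0[OF _ zero])
      fix i assume "i \<in> {1..n}"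
      then have "coeff g (n - i) = mp_eval of_int (\<lambda>i. - b i) (esym n i)"
        unfolding g_b by (intro coeff_prod_linear_esym) simp
      then show "e (coeff f (n - i)) = mp_eval of_int (\<lambda>i. - b i) (esym n i)"
        by (simp add: g_def coeff_map_poly_hom_on[OF U])
    qed (use assms(1) in simp)
    moreover interpret E: comm_ring_hom e
      using e e0 by unfold_locales (auto simp: hom_on_def)
    have "e (mp_eval of_int (\<lambda>i. coeff f (n - i)) (h n)) = mp_eval of_int (\<lambda>i. e (coeff f (n - i))) (h n)"
      by (simp add: E.hom_mp_eval E.hom_of_int)
    ultimately have "e (mp_eval of_int (\<lambda>i. coeff f (n - i)) (h n)) = e 0" using e0 by simp
    then show False using assms(8) injD[OF inj_e] by blast
  qed
  have n: "n > 0" using assms(1) by simp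
  note basis = cyclic_normal_basis[OF \<tau>(1) n order det[unfolded b_def], folded b_def]
  have indep: "\<forall>r\<in>R. c r = 0" if sum: "(\<Sum>r\<in>R. e (c r) * r) = 0" for c
  proof
    fix s assume "s \<in> R"
    then obtain i where i: "i < n" "s = b i" using bij by (auto simp: bij_betw_def)
    have "(\<Sum>i<n. e (c (b i)) * b i) = 0"
      using sum sum.reindex_bij_betw[OF bij, of "\<lambda>r. e (c r) * r"] by simp
    then have "e (c (b i)) = 0" using basis(1)[of "\<lambda>i. e (c (b i))" i] \<tau>(2) i by simp
    then show "c s = 0" using i e0 injD[OF inj_e] by metis
  qed
  have span: "\<exists>c. y = (\<Sum>r\<in>R. e (c r) * r)" for y
  proof -
    obtain c' where c': "\<And>i. i < n \<Longrightarrow> \<tau> (c' i) = c' i" "y = (\<Sum>i<n. c' i * b i)"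
      using basis(2)[of y] by blast
    \<comment> \<open>The inner inverse turns a root into its index along the orbit; the outer one
      takes the coefficient back to the base field, which is possible because \<tau> fixes
      it.\<close>
    define c where "c s = inv_into UNIV e (c' (inv_into {..<n} b s))" for s
    have "e (c (b i)) = c' i" if "i < n" for i
      using that fixed[OF c'(1)[OF that]] bij_betw_inv_into_left[OF bij, of i]
      by (simp add: c_def f_inv_into_f)
    then have "y = (\<Sum>i<n. e (c (b i)) * b i)" using c'(2) by simp
    also have "\<dots> = (\<Sum>r\<in>R. e (c r) * r)"
      by (rule sum.reindex_bij_betw[OF bij, of "\<lambda>r. e (c r) * r"])
    finally show ?thesis by blast
  qed
  show ?thesis unfolding Let_def using indep span unfolding g_def by blast
qed

end
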